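(* For each integer $\kappa\ge 0$ and each integer $\ell\ge 1$, provided $u\ge \ell$ ($u$ real), $$K_{\ell}(u,\kappa)=\sum_{m=0}^{\min(\kappa,\ell)}\ \sum_{n=m}^{\kappa}\ \sum_{r=0}^{\ell-m} D_{m,n,r,\kappa,\ell}\ u^{\kappa-n}(\log u)^{\ell-m-r}+O_{\kappa,\ell}\left(\frac{(\log (eu))^{\ell}}{u}\right),$$ where $$D_{m,n,r,\kappa,\ell}=\frac{(-1)^r\,\Gamma(\kappa+1)\,E_{n,m}}{m!\,(\ell-m-r)!}\,C_{r,\kappa-n},$$ and the constants $C_{r,k}$ (for integers $r,k\ge0$) and $E_{n,m}$ (for integers $n,m\ge 0$) are generated by $$\sum_{r=0}^{\infty}C_{r,k}\,z^{r}=\frac{e^{\gamma z}}{\Gamma(k+1-z)},\qquad \sum_{n=0}^{\infty}E_{n,m}\,z^{n}=\mathrm{Ein}(z)^m .$$ The implied constant in the error term depends only on $\kappa$ and $\ell$ (it is uniform in $u\ge\ell$).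
   Context: For integers $\ell,\kappa\ge 0$ and real $u$, $K_\ell(u,\kappa)$ is defined by: $K_\ell(u,\kappa):=0$ when $\ell\ge u$; for $u>\ell$, $K_0(u,\kappa):=u^\kappa$, and for $\ell\ge 1$ $$K_{\ell}(u,\kappa):=\frac{1}{\ell!}\int\cdots\int_{\substack{t_{1},\ldots,t_{\ell}\ge1\\ t_{1}+\cdots+t_{\ell}\le u}}\bigl(u-(t_{1}+\cdots+t_{\ell})\bigr)^{\kappa}\,\frac{dt_{1}}{t_{1}}\cdots\frac{dt_{\ell}}{t_{\ell}}.$$ The entire function $\mathrm{Ein}$ is $\mathrm{Ein}(z):=\int_0^z\frac{1-e^{-t}}{t}\,dt$. $\gamma$ is Euler's constant, and $1/\Gamma$ is the entire reciprocal Gamma function. Conventions: $\mathrm{Ein}(z)^0=1$ and $x^0=1$ for all $x$, including $x=0$. *)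

theory Defs
  imports "HOL-Complex_Analysis.Complex_Analysis"
begin

text \<open>
  The integration variables \<open>t\<^sub>1, \<dots>, t\<^sub>\<ell>\<close> are the values \<open>t 0, \<dots>, t (\<ell> - 1)\<close> of a point \<open>t\<close> of the
  product of \<open>\<ell>\<close> copies of Lebesgue measure on the real line, so that \<open>\<ell>\<close> can be an arbitrary number.
\<close>

definition K :: "nat \<Rightarrow> real \<Rightarrow> nat \<Rightarrow> real" where
  "K l u \<kappa> =
     (if u \<le> real l then 0
      else if l = 0 then u ^ \<kappa>
      else 1 / fact l *
        (LINT t : {t. (\<forall>i<l. 1 \<le> t i) \<and> (\<Sum>i<l. t i) \<le> u} | (\<Pi>\<^sub>M i\<in>{..<l}. lborel).
           (u - (\<Sum>i<l. t i)) ^ \<kappa> * (\<Prod>i<l. 1 / t i)))"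

text \<open>
  The value of the integrand at \<open>t = 0\<close>, where the division yields 0, does not affect the integral.
\<close>

definition Ein :: "complex \<Rightarrow> complex" where
  "Ein z = contour_integral (linepath 0 z) (\<lambda>t. (1 - exp (- t)) / t)"

text \<open>
  \<open>C_coeff\<close> and \<open>E_coeff\<close> are Taylor coefficients at 0; the lemmas \<open>C_coeff_sums\<close> and \<open>E_coeff_sums\<close>
  below show that they are generated by the respective functions on the whole complex plane.
\<close>

definition C_coeff :: "nat \<Rightarrow> nat \<Rightarrow> complex" where
  "C_coeff r k =
     fps_nth (fps_expansion (\<lambda>z. exp (euler_mascheroni * z) * rGamma (of_nat k + 1 - z)) 0) r"

definition E_coeff :: "nat \<Rightarrow> nat \<Rightarrow> complex" where
  "E_coeff n m = fps_nth (fps_expansion (\<lambda>z. Ein z ^ m) 0) n"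

definition D_coeff :: "nat \<Rightarrow> nat \<Rightarrow> nat \<Rightarrow> nat \<Rightarrow> nat \<Rightarrow> complex" where
  "D_coeff m n r \<kappa> l =
     (- 1) ^ r * Gamma (of_nat \<kappa> + 1) * E_coeff n m / (fact m * fact (l - m - r)) * C_coeff r (\<kappa> - n)"

lemma Ein_holomorphic: "Ein holomorphic_on A"
proof -
  define g :: "complex \<Rightarrow> complex" where "g t = (if t = 0 then 1 else (1 - exp (- t)) / t)" for t
  have d: "deriv (\<lambda>t::complex. - exp (- t)) 0 = 1"
    by (rule DERIV_imp_deriv) (auto intro!: derivative_eq_intros)
  have "(\<lambda>t::complex. if t = 0 then deriv (\<lambda>t. - exp (- t)) 0
          else (- exp (- t) - (- exp (- 0))) / (t - 0)) holomorphic_on UNIV"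
    by (rule pole_lemma) (auto intro!: holomorphic_intros)
  also have "(\<lambda>t::complex. if t = 0 then deriv (\<lambda>t. - exp (- t)) 0
          else (- exp (- t) - (- exp (- 0))) / (t - 0)) = g"
    unfolding d g_def by auto
  finally obtain G where G: "\<And>z. (G has_field_derivative g z) (at z)"
    using holomorphic_convex_primitive'[of UNIV g] by auto
  have "Ein z = G z - G 0" for z
  proof (cases "z = 0")
    case False
    have "(g has_contour_integral (G z - G 0)) (linepath 0 z)"
      using contour_integral_primitive[of UNIV G g "linepath 0 z"] G by auto
    hence "((\<lambda>x. g (linepath 0 z x) * z) has_integral (G z - G 0)) {0..1}"
      by (simp add: has_contour_integral_linepath)
    hence "((\<lambda>x. (1 - exp (- linepath 0 z x)) / linepath 0 z x * z) has_integral (G z - G 0)) {0..1}"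
      by (rule has_integral_spike_finite[of "{0}", rotated 2])
         (use False in \<open>auto simp: g_def linepath_def\<close>)
    hence "((\<lambda>t. (1 - exp (- t)) / t) has_contour_integral (G z - G 0)) (linepath 0 z)"
      by (simp add: has_contour_integral_linepath)
    thus ?thesis
      unfolding Ein_def by (rule contour_integral_unique)
  qed (simp add: Ein_def)
  hence "Ein = (\<lambda>z. G z - G 0)"
    by auto
  moreover have "(\<lambda>z. G z - G 0) holomorphic_on A"
    using G by (auto simp: holomorphic_on_def field_differentiable_def
                     intro!: exI DERIV_subset[OF DERIV_diff[OF _ DERIV_const]])
  ultimately show ?thesis
    by (simp only:)
qed

lemma fps_expansion_sums:
  assumes "f holomorphic_on UNIV"
  shows "(\<lambda>n. fps_nth (fps_expansion f 0) n * z ^ n) sums f z"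
proof -
  have "f holomorphic_on ball 0 (norm z + 1)"
    using assms by (rule holomorphic_on_subset) simp
  from holomorphic_power_series[OF this, of z] show ?thesis
    by (simp add: fps_expansion_def)
qed

lemma C_coeff_sums:
  "(\<lambda>r. C_coeff r k * z ^ r) sums (exp (euler_mascheroni * z) * rGamma (of_nat k + 1 - z))"
  unfolding C_coeff_def
  by (rule fps_expansion_sums) (intro holomorphic_intros)

lemma E_coeff_sums: "(\<lambda>n. E_coeff n m * z ^ n) sums (Ein z ^ m)"
  unfolding E_coeff_def
  by (rule fps_expansion_sums) (intro holomorphic_intros Ein_holomorphic)

end

theory Submission
  imports Defs "HOL-Real_Asymp.Real_Asymp"
begin

text \<open>
  Let \<open>f\<^sub>l u = l! * K l u \<kappa>\<close>. Integrating one variable at a time, \<open>f\<^sub>l\<^sub>+\<^sub>1\<close> is the convolution of \<open>f\<^sub>l\<close> with the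
  function \<open>1 / t\<close> on \<open>t \<ge> 1\<close>, whose Laplace transform is the exponential integral
  \<open>Ein s - \<gamma> - log s\<close>. So \<open>f\<^sub>l\<close> has transform \<open>\<kappa>! * s\<^bsup>-\<kappa>-1\<^esup> * (Ein s - \<gamma> - log s)\<^bsup>l\<^esup>\<close>. Expanding this by the
  binomial theorem and replacing the powers of \<open>Ein\<close> by their Taylor polynomials of degree \<open>\<kappa>\<close> leaves
  multiples of \<open>s\<^bsup>-k-1\<^esup> * (- \<gamma> - log s)\<^bsup>j\<^esup> / j!\<close>. This is the transform of the function \<open>power_log k j\<close>: the
  coefficient of \<open>x\<^bsup>j\<^esup>\<close> in \<open>exp (- \<gamma> * x) * u\<^bsup>k+x\<^esup> / \<Gamma> (k + x + 1)\<close>, which has the transform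
  \<open>s\<^bsup>-k-1\<^esup> * exp (x * (- \<gamma> - log s))\<close>. The result is the claimed main term.

  The proof does not invert a transform. It shows that the main terms satisfy the same recursion in \<open>l\<close> as
  the \<open>f\<^sub>l\<close>, up to an admissible error. By the picture above, convolving with \<open>1 / t\<close> must act as the
  multiplication by \<open>(- \<gamma> - log s) + Ein s\<close>. The first summand maps \<open>power_log k j\<close> to
  \<open>(j + 1) * power_log k (j + 1)\<close>, and the term \<open>E\<^sub>i\<^sub>,\<^sub>1 * s\<^bsup>i\<^esup>\<close> of the second maps it to
  \<open>E\<^sub>i\<^sub>,\<^sub>1 * power_log (k - i) j\<close>. The heart of the proof is \<open>convolution_defect_bound\<close>, which states this
  with an error \<open>O(log\<^bsup>j\<^esup> (e * u) / u)\<close>.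
  It is proved for all \<open>j\<close> at once with the generating function in \<open>x\<close>. The integral of \<open>(u - t)\<^bsup>a\<^esup> / t\<close> is
  explicit (\<open>has_integral_power_over_t\<close>): the digamma value in it also arises when \<open>1 / \<Gamma>\<close> is differentiated
  in \<open>x\<close>, and the binomial coefficients in it match the Taylor coefficients of \<open>Ein\<close>. The remainder is \<open>O(1 / u)\<close> for
  \<open>\<bar>x\<bar> < 1 / (2 * log (e * u))\<close>, where \<open>u\<^bsup>x\<^esup>\<close> is bounded, and Cauchy's inequality on this disc bounds each
  coefficient.

  Given this, Pascal's rule and \<open>Ein\<^bsup>m+1\<^esup> = Ein * Ein\<^bsup>m\<^esup>\<close> turn the convolution of the main term of level \<open>l\<close>
  into the one of level \<open>l + 1\<close> (\<open>main_term_Suc\<close>, \<open>integral_main_term\<close>). An error \<open>log\<^bsup>l\<^esup> (e * u) / u\<close> gains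
  just one logarithm under convolution, because the integral of \<open>1 / ((u - t) * t)\<close> over
  \<open>1 \<le> t \<le> u - 1\<close> is \<open>2 * log (u - 1) / u\<close>. Induction on \<open>l\<close> gives \<open>iter_conv_asymptotics\<close>.
\<close>

section \<open>Taylor coefficients of powers of Ein\<close>

text \<open>
  Integrate the power series of \<open>(1 - exp (- t)) / t\<close> term by term. The formula also covers \<open>n = 0\<close>,
  because the division by zero yields the correct value 0.
\<close>

lemma E_coeff_one: "E_coeff n 1 = (- 1) ^ Suc n / (of_nat n * fact n)"
proof -
  define e :: "nat \<Rightarrow> complex" where "e n = (- 1) ^ Suc n / (of_nat n * fact n)" for n
  define S where "S z = (\<Sum>n. e n * z ^ n)" for z
  define S' where "S' z = (\<Sum>n. diffs e n * z ^ n)" for z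
  have sm: "summable (\<lambda>n. e n * z ^ n)" for z
  proof (rule summable_comparison_test'[OF summable_norm_exp[of z]])
    fix n
    have "norm (e n) \<le> inverse (fact n)"
    proof (cases "n = 0")
      case False
      hence "1 / (real n * fact n) \<le> 1 / (1 * fact n)"
        by (intro divide_left_mono mult_right_mono) auto
      thus ?thesis
        by (simp add: e_def norm_divide norm_mult norm_power inverse_eq_divide)
    qed (simp add: e_def)
    thus "norm (e n * z ^ n) \<le> norm (z ^ n /\<^sub>R fact n)"
      by (simp add: norm_mult norm_power mult_right_mono)
  qed
  have D: "(S has_field_derivative S' z) (at z)" for z
    unfolding S_def S'_def by (rule termdiffs_strong_converges_everywhere[OF sm])
  have S'_eq: "S' z = (1 - exp (- z)) / z" if z: "z \<noteq> 0" for z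
  proof -
    have "(\<lambda>n. (- z) ^ n /\<^sub>R fact n) sums exp (- z)"
      by (rule exp_converges)
    hence "(\<lambda>n. (- z) ^ Suc n /\<^sub>R fact (Suc n)) sums (exp (- z) - 1)"
      by (subst sums_Suc_iff) simp
    hence "(\<lambda>n. (- (1 / z)) * ((- z) ^ Suc n /\<^sub>R fact (Suc n))) sums ((- (1 / z)) * (exp (- z) - 1))"
      by (rule sums_mult)
    also have "(\<lambda>n. (- (1 / z)) * ((- z) ^ Suc n /\<^sub>R fact (Suc n))) = (\<lambda>n. diffs e n * z ^ n)"
    proof
      fix n
      have "(- z) ^ Suc n = (- 1) ^ Suc n * z ^ Suc n"
        by (rule power_minus)
      moreover have "of_nat (Suc n) \<noteq> (0 :: complex)"
        using of_nat_neq_0 by blast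
      ultimately show "(- (1 / z)) * ((- z) ^ Suc n /\<^sub>R fact (Suc n)) = diffs e n * z ^ n"
        using z by (simp add: diffs_def e_def scaleR_conv_of_real divide_simps del: of_nat_Suc fact_Suc)
    qed
    finally show ?thesis
      using z by (simp add: S'_def sums_iff field_simps)
  qed
  have "Ein z = S z" for z
  proof (cases "z = 0")
    case True
    have "S 0 = 0"
      unfolding S_def powser_zero by (simp add: e_def)
    thus ?thesis using True by (simp add: Ein_def)
  next
    case False
    have "(S' has_contour_integral (S z - S 0)) (linepath 0 z)"
      using contour_integral_primitive[of UNIV S S' "linepath 0 z"] D by auto
    hence "((\<lambda>x. S' (linepath 0 z x) * z) has_integral (S z - S 0)) {0..1}"
      by (simp add: has_contour_integral_linepath)
    hence "((\<lambda>x. (1 - exp (- linepath 0 z x)) / linepath 0 z x * z) has_integral (S z - S 0)) {0..1}"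
      by (rule has_integral_spike_finite[of "{0}", rotated 2])
         (use False in \<open>auto simp: S'_eq linepath_def\<close>)
    hence "((\<lambda>t. (1 - exp (- t)) / t) has_contour_integral (S z - S 0)) (linepath 0 z)"
      by (simp add: has_contour_integral_linepath)
    moreover have "S 0 = 0"
      unfolding S_def powser_zero by (simp add: e_def)
    ultimately show ?thesis
      unfolding Ein_def by (simp add: contour_integral_unique)
  qed
  hence "(\<lambda>n. fps_nth (Abs_fps e) n * z ^ n) sums Ein z" for z
    using sm[of z] by (simp add: S_def summable_sums)
  hence "Ein has_fps_expansion Abs_fps e"
    by (intro has_fps_expansionI always_eventually) auto
  hence "fps_expansion Ein 0 = Abs_fps e"
    by (rule fps_expansion_eqI)
  thus ?thesis
    by (simp add: E_coeff_def e_def)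
qed

lemma Abs_fps_E_coeff: "Abs_fps (\<lambda>n. E_coeff n m) = Abs_fps (\<lambda>n. E_coeff n 1) ^ m"
proof -
  have h: "(\<lambda>z. Ein z ^ k) has_fps_expansion Abs_fps (\<lambda>n. E_coeff n k)" for k
    using E_coeff_sums[of k] by (intro has_fps_expansionI always_eventually) auto
  have "Ein has_fps_expansion Abs_fps (\<lambda>n. E_coeff n 1)"
    using h[of 1] by simp
  hence "(\<lambda>z. Ein z ^ m) has_fps_expansion Abs_fps (\<lambda>n. E_coeff n 1) ^ m"
    by (rule has_fps_expansion_power)
  with h[of m] show ?thesis
    by (rule fps_expansion_unique_complex)
qed

lemma E_coeff_zero_right: "E_coeff n 0 = (if n = 0 then 1 else 0)"
  using arg_cong[OF Abs_fps_E_coeff[of 0], of "\<lambda>F. fps_nth F n"] by simp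

lemma E_coeff_Suc_right: "E_coeff n (Suc m) = (\<Sum>i\<le>n. E_coeff i 1 * E_coeff (n - i) m)"
proof -
  have "Abs_fps (\<lambda>n. E_coeff n (Suc m)) = Abs_fps (\<lambda>n. E_coeff n 1) * Abs_fps (\<lambda>n. E_coeff n m)"
    unfolding Abs_fps_E_coeff[of "Suc m"] Abs_fps_E_coeff[of m] by simp
  from arg_cong[OF this, of "\<lambda>F. fps_nth F n"] show ?thesis
    by (simp add: fps_mult_nth atLeast0AtMost)
qed

lemma E_coeff_eq_0: "n < m \<Longrightarrow> E_coeff n m = 0"
  using arg_cong[OF Abs_fps_E_coeff[of m], of "\<lambda>F. fps_nth F n"]
        startsby_zero_power_prefix[of "Abs_fps (\<lambda>n. E_coeff n 1)" m] E_coeff_one[of 0]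
  by simp

section \<open>The integral of a complex power against 1/t\<close>

text \<open>
  \<open>binom_log a\<close> is the power series of the primitive of \<open>(1 - (1 - w)\<^bsup>a\<^esup>) / w\<close> that vanishes at 0. Its constant
  coefficient is 0, again through a division by zero; keeping the index 0 aligns it with \<open>E_coeff i 1\<close>.
\<close>

definition binom_log_coeff :: "complex \<Rightarrow> nat \<Rightarrow> complex" where
  "binom_log_coeff a n = (- 1) ^ Suc n * (a gchoose n) / of_nat n"

definition binom_log :: "complex \<Rightarrow> complex \<Rightarrow> complex" where
  "binom_log a w = (\<Sum>n. binom_log_coeff a n * w ^ n)"

text \<open>
  \<open>y\<^bsup>a+1\<^esup> * lerch a y\<close> is the incomplete beta function: the primitive of \<open>y\<^bsup>a\<^esup> / (1 - y)\<close> that vanishes at 0.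
\<close>

definition lerch :: "complex \<Rightarrow> complex \<Rightarrow> complex" where
  "lerch a y = (\<Sum>n. y ^ n / (a + 1 + of_nat n))"

lemma norm_binom_log_coeff_le: "norm (binom_log_coeff a n) \<le> norm (a gchoose n)"
proof (cases "n = 0")
  case False
  hence "norm (a gchoose n) / real n \<le> norm (a gchoose n) / 1"
    by (intro divide_left_mono) auto
  thus ?thesis
    by (simp add: binom_log_coeff_def norm_mult norm_divide norm_power)
qed (simp add: binom_log_coeff_def)

lemma binom_log_summable_norm:
  assumes "norm w < 1"
  shows "summable (\<lambda>n. norm (binom_log_coeff a n * w ^ n))"
proof -
  obtain r where r: "norm w < r" "r < 1"
    using dense[OF assms] by blast
  hence "norm (complex_of_real r) < 1"
    using norm_ge_zero[of w] by (simp del: norm_ge_zero)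
  hence "summable (\<lambda>n. (a gchoose n) * complex_of_real r ^ n)"
    using gen_binomial_complex sums_summable by blast
  hence s: "summable (\<lambda>n. norm ((a gchoose n) * w ^ n))"
    by (rule powser_insidea) (use r in auto)
  show ?thesis
  proof (rule summable_comparison_test'[OF s])
    fix n :: nat
    show "norm (norm (binom_log_coeff a n * w ^ n)) \<le> norm ((a gchoose n) * w ^ n)"
      unfolding norm_mult real_norm_def abs_mult abs_norm_cancel
      by (intro mult_right_mono norm_binom_log_coeff_le) auto
  qed
qed

lemma binom_log_summable: "norm w < 1 \<Longrightarrow> summable (\<lambda>n. binom_log_coeff a n * w ^ n)"
  by (rule summable_norm_cancel[OF binom_log_summable_norm])

lemma binom_log_deriv:
  assumes "norm w < 1"
  shows "(binom_log a has_field_derivative (\<Sum>n. diffs (binom_log_coeff a) n * w ^ n)) (at w)"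
  unfolding binom_log_def
  using binom_log_summable assms by (rule termdiffs_strong')

lemma binom_log_deriv_eq:
  assumes "norm w < 1"
  shows "w * (\<Sum>n. diffs (binom_log_coeff a) n * w ^ n) = 1 - (1 - w) powr a"
proof -
  have "(\<lambda>n. (a gchoose n) * (- w) ^ n) sums ((1 - w) powr a)"
    using gen_binomial_complex[of "- w" a] assms by simp
  hence "(\<lambda>n. (a gchoose Suc n) * (- w) ^ Suc n) sums ((1 - w) powr a - 1)"
    by (subst sums_Suc_iff) simp
  hence "(\<lambda>n. - ((a gchoose Suc n) * (- w) ^ Suc n)) sums (1 - (1 - w) powr a)"
    using sums_minus by fastforce
  also have "(\<lambda>n. - ((a gchoose Suc n) * (- w) ^ Suc n)) = (\<lambda>n. w * (diffs (binom_log_coeff a) n * w ^ n))"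
  proof
    fix n
    have "(- w) ^ Suc n = (- 1) ^ Suc n * w ^ Suc n"
      by (rule power_minus)
    moreover have "of_nat (Suc n) \<noteq> (0 :: complex)"
      using of_nat_neq_0 by blast
    ultimately show "- ((a gchoose Suc n) * (- w) ^ Suc n) = w * (diffs (binom_log_coeff a) n * w ^ n)"
      by (simp add: diffs_def binom_log_coeff_def del: of_nat_Suc)
  qed
  finally have 1: "(\<lambda>n. w * (diffs (binom_log_coeff a) n * w ^ n)) sums (1 - (1 - w) powr a)" .
  have "summable (\<lambda>n. diffs (binom_log_coeff a) n * w ^ n)"
    by (rule termdiff_converges[OF assms]) (rule binom_log_summable)
  hence "(\<lambda>n. w * (diffs (binom_log_coeff a) n * w ^ n)) sums (w * (\<Sum>n. diffs (binom_log_coeff a) n * w ^ n))"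
    by (intro sums_mult summable_sums)
  thus ?thesis
    using 1 sums_unique2 by blast
qed

lemma norm_lerch_denominator:
  assumes "Re a \<ge> - 1 / 2"
  shows "norm (a + 1 + of_nat n) \<ge> (real n + 1) / 2"
proof -
  have "(real n + 1) / 2 \<le> Re (a + 1 + of_nat n)"
    using assms by simp
  also have "\<dots> \<le> norm (a + 1 + of_nat n)"
    by (rule complex_Re_le_cmod)
  finally show ?thesis .
qed

lemma lerch_term_bound:
  assumes "Re a \<ge> - 1 / 2"
  shows "norm (y ^ n / (a + 1 + of_nat n)) \<le> 2 * norm y ^ n"
proof -
  have "(1::real) / 2 \<le> norm (a + 1 + of_nat n)"
    using norm_lerch_denominator[OF assms, of n] by (simp add: field_simps)
  hence "norm y ^ n * 1 \<le> norm y ^ n * (2 * norm (a + 1 + of_nat n))"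
    by (intro mult_left_mono) auto
  thus ?thesis
    using \<open>1 / 2 \<le> _\<close> by (simp add: norm_divide norm_power divide_le_eq mult_ac)
qed

lemma lerch_summable_norm:
  assumes "Re a \<ge> - 1 / 2" "norm y < 1"
  shows "summable (\<lambda>n. norm (y ^ n / (a + 1 + of_nat n)))"
  by (rule summable_comparison_test'[of "\<lambda>n. 2 * norm y ^ n"])
     (use lerch_term_bound[OF assms(1)] assms in \<open>auto intro!: summable_mult\<close>)

lemma norm_lerch_le:
  assumes "Re a \<ge> - 1 / 2" "norm y \<le> 1 / 2"
  shows "norm (lerch a y) \<le> 4"
proof -
  have s: "summable (\<lambda>n. norm (y ^ n / (a + 1 + of_nat n)))"
    using assms by (intro lerch_summable_norm) auto
  have "norm (lerch a y) \<le> (\<Sum>n. norm (y ^ n / (a + 1 + of_nat n)))"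
    unfolding lerch_def by (rule summable_norm[OF s])
  also have "\<dots> \<le> (\<Sum>n. 2 * (1 / 2) ^ n)"
  proof (rule suminf_le[OF _ s])
    show "norm (y ^ n / (a + 1 + of_nat n)) \<le> 2 * (1 / 2) ^ n" for n
      using lerch_term_bound[OF assms(1), of y n] power_mono[OF assms(2), of n] by simp
  qed (auto intro!: summable_mult)
  also have "\<dots> = 4"
    by (subst suminf_mult) (auto simp: suminf_geometric)
  finally show ?thesis .
qed

lemma lerch_deriv:
  assumes a: "Re a \<ge> - 1 / 2" and y: "norm y < 1" "y \<notin> \<real>\<^sub>\<le>\<^sub>0"
  shows "((\<lambda>y. y powr (a + 1) * lerch a y) has_field_derivative y powr a / (1 - y)) (at y)"
proof -
  define c where "c n = inverse (a + 1 + of_nat n)" for n :: nat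
  have nz: "a + 1 + of_nat n \<noteq> 0" for n
    using norm_lerch_denominator[OF a, of n] by auto
  have sm: "summable (\<lambda>n. c n * z ^ n)" if "norm z < 1" for z
    using lerch_summable_norm[OF a that, THEN summable_norm_cancel]
    by (simp add: c_def divide_inverse mult_ac)
  have L: "lerch a = (\<lambda>y. \<Sum>n. c n * y ^ n)"
    by (simp add: lerch_def[abs_def] c_def divide_inverse mult_ac)
  have sd: "summable (\<lambda>n. diffs c n * y ^ n)"
    by (rule termdiff_converges[OF y(1)]) (use sm in auto)
  have D: "(lerch a has_field_derivative (\<Sum>n. diffs c n * y ^ n)) (at y)"
    unfolding L by (rule termdiffs_strong'[OF sm y(1)])
  have "(\<lambda>n. of_nat n * c n * y ^ n) sums (y * (\<Sum>n. diffs c n * y ^ n))"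
  proof -
    have "(\<lambda>n. y * (diffs c n * y ^ n)) sums (y * (\<Sum>n. diffs c n * y ^ n))"
      by (intro sums_mult summable_sums sd)
    also have "(\<lambda>n. y * (diffs c n * y ^ n)) = (\<lambda>n. of_nat (Suc n) * c (Suc n) * y ^ Suc n)"
      by (simp add: diffs_def mult_ac)
    finally show ?thesis
      by (subst (asm) sums_Suc_iff) simp
  qed
  moreover have "(\<lambda>n. (a + 1) * (c n * y ^ n)) sums ((a + 1) * lerch a y)"
    unfolding L by (intro sums_mult summable_sums sm y)
  ultimately have "(\<lambda>n. of_nat n * c n * y ^ n + (a + 1) * (c n * y ^ n)) sums
      (y * (\<Sum>n. diffs c n * y ^ n) + (a + 1) * lerch a y)"
    by (rule sums_add)
  also have "(\<lambda>n. of_nat n * c n * y ^ n + (a + 1) * (c n * y ^ n)) = (\<lambda>n. y ^ n)"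
  proof
    fix n
    have "of_nat n * c n * y ^ n + (a + 1) * (c n * y ^ n) = (a + 1 + of_nat n) * c n * y ^ n"
      by (simp add: algebra_simps)
    thus "of_nat n * c n * y ^ n + (a + 1) * (c n * y ^ n) = y ^ n"
      using nz by (simp add: c_def)
  qed
  finally have eq: "y * (\<Sum>n. diffs c n * y ^ n) + (a + 1) * lerch a y = 1 / (1 - y)"
    using geometric_sums[OF y(1)] sums_unique2 by blast
  have y0: "y \<noteq> 0"
    using y by auto
  have pw: "y powr (a + 1) = y powr a * y"
    using y0 by (simp add: powr_add)
  have "((\<lambda>y. y powr (a + 1) * lerch a y) has_field_derivative
          (a + 1) * y powr (a + 1 - 1) * lerch a y + (\<Sum>n. diffs c n * y ^ n) * y powr (a + 1)) (at y)"
    by (intro DERIV_mult has_field_derivative_powr D y)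
  also have "(a + 1) * y powr (a + 1 - 1) * lerch a y + (\<Sum>n. diffs c n * y ^ n) * y powr (a + 1) =
      y powr a * (y * (\<Sum>n. diffs c n * y ^ n) + (a + 1) * lerch a y)"
    unfolding pw by (simp add: algebra_simps)
  also have "\<dots> = y powr a / (1 - y)"
    by (simp add: eq)
  finally show ?thesis .
qed

text \<open>
  As \<open>w\<close> tends to 0, both \<open>log w\<close> and the Lerch term diverge, but since \<open>- log w\<close> is the power series
  \<open>\<Sum>y\<^bsup>n+1\<^esup> / (n + 1)\<close> at \<open>y = 1 - w\<close>, the sum of the two is essentially the series of
  \<open>y\<^bsup>n+1\<^esup> * (1 / (a + n + 1) - 1 / (n + 1))\<close>. Its coefficients are \<open>O(1 / n\<^sup>2)\<close>, so it is continuous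
  up to \<open>y = 1\<close>, where it is minus the series that defines \<open>\<psi> (a + 1) + \<gamma>\<close>.
\<close>

lemma lerch_limit:
  assumes a: "Re a \<ge> - 1 / 2"
  shows "((\<lambda>w::real. of_real (ln w) - binom_log a w + (1 - of_real w) powr (a + 1) * lerch a (1 - of_real w))
           \<longlongrightarrow> - (euler_mascheroni + Digamma (a + 1))) (at_right 0)"
proof -
  define d where "d n = inverse (a + 1 + of_nat n) - inverse (of_nat (Suc n))" for n :: nat
  define S where "S y = (\<Sum>n. d n * y ^ n)" for y :: real
  have nz: "a + 1 + of_nat n \<noteq> 0" for n
    using norm_lerch_denominator[OF a, of n] by auto
  have dn: "norm (d n) \<le> 2 * norm a * inverse (real (Suc n) ^ 2)" for n
  proof -
    have "d n = - a / ((a + 1 + of_nat n) * of_nat (Suc n))"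
      using nz[of n] of_nat_neq_0[where 'a = complex, of n]
      by (simp add: d_def divide_simps del: of_nat_Suc) (simp add: algebra_simps)
    hence "norm (d n) = norm a / (norm (a + 1 + of_nat n) * real (Suc n))"
      by (simp add: norm_divide norm_mult del: of_nat_Suc)
    also have "\<dots> \<le> norm a / (real (Suc n) / 2 * real (Suc n))"
    proof (intro divide_left_mono mult_right_mono)
      have "(0::real) < (real n + 1) / 2" by simp
      also have "\<dots> \<le> norm (a + 1 + of_nat n)"
        by (rule norm_lerch_denominator[OF a])
      finally show "0 < norm (a + 1 + of_nat n) * real (Suc n) * (real (Suc n) / 2 * real (Suc n))"
        by simp
      show "real (Suc n) / 2 \<le> norm (a + 1 + of_nat n)"
        using norm_lerch_denominator[OF a, of n] by (simp add: add_ac)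
    qed auto
    also have "\<dots> = 2 * norm a * inverse (real (Suc n) ^ 2)"
      by (simp add: field_simps power2_eq_square)
    finally show ?thesis .
  qed
  have sq: "summable (\<lambda>n. 2 * norm a * inverse (real (Suc n) ^ 2))"
    by (intro summable_mult) (use inverse_power_summable[of 2, where 'a = real] in \<open>subst summable_Suc_iff, simp\<close>)
  have dy: "norm (d n * y ^ n) \<le> 2 * norm a * inverse (real (Suc n) ^ 2)" if "y \<in> {0..1}" for n and y :: real
  proof -
    have "norm (d n * y ^ n) \<le> norm (d n) * 1"
      unfolding norm_mult using that by (intro mult_left_mono) (auto simp: norm_power power_le_one)
    thus ?thesis
      using dn[of n] by simp
  qed
  have "continuous_on {0..1} S"
  proof (rule uniform_limit_theorem)
    show "\<forall>\<^sub>F N in sequentially. continuous_on {0..1} (\<lambda>y::real. \<Sum>n<N. d n * y ^ n)"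
      by (intro always_eventually allI continuous_intros)
    show "uniform_limit {0..1} (\<lambda>N y. \<Sum>n<N. d n * of_real y ^ n) S sequentially"
      unfolding S_def of_real_power by (rule Weierstrass_m_test[OF _ sq]) (use dy in auto)
  qed simp
  hence S1: "(S \<longlongrightarrow> S 1) (at 1 within {0..1})"
    by (simp add: continuous_on_def)
  have "filterlim (\<lambda>w::real. 1 - w) (at 1 within {0..1}) (at_right 0)"
  proof -
    have "\<forall>\<^sub>F w::real in at_right 0. 1 - w \<in> {0..1} \<and> 1 - w \<noteq> 1"
      using eventually_at_right_less[of 0] eventually_at_right_field[of _ "0::real"]
      by (auto simp: eventually_at_right_field intro!: exI[of _ "1::real"])
    moreover have "((\<lambda>w::real. 1 - w) \<longlongrightarrow> 1) (at_right 0)"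
      by (auto intro!: tendsto_eq_intros)
    ultimately show ?thesis
      by (auto simp: filterlim_at)
  qed
  from filterlim_compose[OF S1 this] have lim1: "((\<lambda>w. S (1 - w)) \<longlongrightarrow> S 1) (at_right 0)" .
  have S1_eq: "S 1 = - (euler_mascheroni + Digamma (a + 1))"
  proof -
    have "summable (\<lambda>n. inverse (of_nat (Suc n)) - inverse (a + 1 + of_nat n))"
      using nz[of 0] by (intro summable_Digamma) simp
    hence "(\<Sum>n. - (inverse (of_nat (Suc n)) - inverse (a + 1 + of_nat n))) =
        - (\<Sum>n. (inverse (of_nat (Suc n)) - inverse (a + 1 + of_nat n)))"
      by (rule suminf_minus)
    thus ?thesis
      unfolding S_def d_def Digamma_def by simp
  qed
  \<comment> \<open>\<open>G\<close> is the derivative of \<open>binom_log a\<close>, so \<open>(1 - w)\<^bsup>a\<^esup> = 1 - w * G w\<close> with \<open>G\<close> continuous at 0. This controls the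
    product of \<open>(1 - w)\<^bsup>a\<^esup> - 1\<close> and \<open>log w\<close>.\<close>
  define G where "G w = (\<Sum>n. diffs (binom_log_coeff a) n * w ^ n)" for w
  have Gc: "isCont G 0"
  proof -
    have "summable (\<lambda>n. diffs (binom_log_coeff a) n * (1 / 2) ^ n)"
      by (rule termdiff_converges[of _ 1]) (auto simp: norm_divide intro: binom_log_summable)
    from isCont_powser[OF this, of 0] show ?thesis
      unfolding G_def by simp
  qed
  have of0: "filterlim complex_of_real (nhds 0) (at_right 0)"
    by (auto intro!: tendsto_eq_intros)
  have limG: "((\<lambda>w::real. G w) \<longlongrightarrow> G 0) (at_right 0)"
    using isCont_tendsto_compose[OF Gc of0] .
  have limB: "((\<lambda>w::real. binom_log a w) \<longlongrightarrow> 0) (at_right 0)"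
  proof -
    have "isCont (binom_log a) 0"
      using binom_log_deriv[of 0] DERIV_isCont by fastforce
    moreover have "binom_log a 0 = 0"
      unfolding binom_log_def powser_zero by (simp add: binom_log_coeff_def)
    ultimately show ?thesis
      using isCont_tendsto_compose[OF _ of0, of "binom_log a"] by simp
  qed
  have xlnx: "((\<lambda>w::real. complex_of_real (w * ln w)) \<longlongrightarrow> 0) (at_right 0)"
  proof -
    have "((\<lambda>w::real. w * ln w) \<longlongrightarrow> 0) (at_right 0)"
      by real_asymp
    from tendsto_of_real[OF this] show ?thesis by simp
  qed
  have "((\<lambda>w::real. complex_of_real (w * ln w) * G w - binom_log a w + (1 - w * G w) * (1 - of_real w) * S (1 - w))
      \<longlongrightarrow> 0 * G 0 - 0 + (1 - 0 * G 0) * (1 - 0) * S 1) (at_right 0)"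
    by (intro tendsto_intros xlnx limG limB lim1 of0)
  hence L: "((\<lambda>w::real. complex_of_real (w * ln w) * G w - binom_log a w + (1 - w * G w) * (1 - of_real w) * S (1 - w))
      \<longlongrightarrow> S 1) (at_right 0)"
    by simp
  have "\<forall>\<^sub>F w::real in at_right 0. w \<in> {0<..<1}"
    by (rule eventually_at_right_real) simp
  hence "\<forall>\<^sub>F w::real in at_right 0. of_real (ln w) - binom_log a w + (1 - of_real w) powr (a + 1) * lerch a (1 - of_real w) =
     complex_of_real (w * ln w) * G w - binom_log a w + (1 - w * G w) * (1 - of_real w) * S (1 - w)"
  proof (rule eventually_mono)
    fix w :: real
    assume w: "w \<in> {0<..<1}"
    define y where "y = 1 - complex_of_real w"
    have ny: "norm y < 1" "y \<noteq> 0"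
    proof -
      have "y = of_real (1 - w)" by (simp add: y_def)
      thus "norm y < 1" "y \<noteq> 0" using w by (simp_all del: of_real_diff)
    qed
    have g: "1 - of_real w * G w = y powr a"
      using binom_log_deriv_eq[of "of_real w" a] w by (simp add: G_def y_def)
    have "(\<lambda>n. y ^ n / (a + 1 + of_nat n)) sums lerch a y"
      unfolding lerch_def by (intro summable_sums summable_norm_cancel[OF lerch_summable_norm] a ny)
    hence s1: "(\<lambda>n. y * (y ^ n / (a + 1 + of_nat n))) sums (y * lerch a y)"
      by (rule sums_mult)
    have s2: "(\<lambda>n. y * (inverse (of_nat (Suc n)) * y ^ n)) sums (- of_real (ln w))"
    proof -
      have "(\<lambda>n. (- 1) ^ Suc n / of_nat n * (- y) ^ n) sums Ln (1 + - y)"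
        using ny by (intro Ln_series) auto
      also have "Ln (1 + - y) = of_real (ln w)"
        using w by (simp add: y_def Ln_of_real)
      also have "(\<lambda>n. (- 1) ^ Suc n / of_nat n * (- y) ^ n) = (\<lambda>n. - (inverse (of_nat n) * y ^ n))"
      proof
        fix n
        have "(- y) ^ n = (- 1) ^ n * y ^ n" by (rule power_minus)
        thus "(- 1) ^ Suc n / of_nat n * (- y) ^ n = - (inverse (of_nat n) * y ^ n)"
          by (simp add: divide_inverse mult_ac)
      qed
      finally have "(\<lambda>n. inverse (of_nat n) * y ^ n) sums (- of_real (ln w))"
        using sums_minus by fastforce
      hence "(\<lambda>n. inverse (of_nat (Suc n)) * y ^ Suc n) sums (- of_real (ln w))"
        by (subst sums_Suc_iff) simp
      thus ?thesis by (simp add: mult_ac)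
    qed
    have "(\<lambda>n. y * (y ^ n / (a + 1 + of_nat n)) - y * (inverse (of_nat (Suc n)) * y ^ n))
        sums (y * lerch a y - (- of_real (ln w)))"
      by (rule sums_diff[OF s1 s2])
    also have "(\<lambda>n. y * (y ^ n / (a + 1 + of_nat n)) - y * (inverse (of_nat (Suc n)) * y ^ n)) =
       (\<lambda>n. y * (d n * y ^ n))"
      by (simp add: d_def divide_inverse algebra_simps)
    finally have "y * lerch a y + of_real (ln w) = (\<Sum>n. y * (d n * y ^ n))"
      by (simp add: sums_iff)
    also have "\<dots> = y * S (1 - w)"
    proof -
      have "summable (\<lambda>n. d n * complex_of_real (1 - w) ^ n)"
        by (rule summable_comparison_test'[OF sq]) (use dy[of "1 - w"] w in auto)
      thus ?thesis
        unfolding S_def y_def of_real_power of_real_diff of_real_1 by (rule suminf_mult)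
    qed
    finally have e: "y * lerch a y = y * S (1 - w) - of_real (ln w)"
      by (simp add: algebra_simps)
    have "y powr (a + 1) * lerch a y = y powr a * (y * lerch a y)"
      using ny by (simp add: powr_add)
    also have "\<dots> = (1 - w * G w) * (y * S (1 - w) - of_real (ln w))"
      by (simp add: e g)
    finally show "of_real (ln w) - binom_log a w + (1 - of_real w) powr (a + 1) * lerch a (1 - of_real w) =
     complex_of_real (w * ln w) * G w - binom_log a w + (1 - w * G w) * (1 - of_real w) * S (1 - w)"
      unfolding y_def by (simp add: algebra_simps)
  qed
  from tendsto_cong[OF this] L S1_eq show ?thesis by simp
qed

text \<open>
  Both sides are primitives of \<open>(1 - w)\<^bsup>a\<^esup> / w\<close>, one expanded at \<open>w = 0\<close> and the other at \<open>w = 1\<close>. The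
  constant between them is its limit at \<open>w = 0\<close>.
\<close>

lemma binom_log_connection:
  fixes w :: real
  assumes a: "Re a \<ge> - 1 / 2" and w: "0 < w" "w < 1"
  shows "of_real (ln w) - binom_log a w =
           - (euler_mascheroni + Digamma (a + 1)) - (1 - of_real w) powr (a + 1) * lerch a (1 - of_real w)"
proof -
  define F where "F = (\<lambda>w::real. of_real (ln w) - binom_log a w + (1 - of_real w) powr (a + 1) * lerch a (1 - of_real w))"
  have D: "(F has_vector_derivative 0) (at w)" if w: "0 < w" "w < 1" for w
  proof -
    define y where "y = 1 - complex_of_real w"
    have yr: "y = of_real (1 - w)" by (simp add: y_def)
    have ny: "norm y < 1" "y \<notin> \<real>\<^sub>\<le>\<^sub>0"
      using w unfolding yr by (auto simp del: of_real_diff)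
    have nw: "norm (complex_of_real w) < 1" using w by simp
    have L: "((\<lambda>x::complex. (1 - x) powr (a + 1) * lerch a (1 - x)) has_field_derivative
       (y powr a / (1 - y)) * (- 1)) (at (of_real w))"
      by (rule DERIV_chain2[where g = "\<lambda>x. 1 - x" and f = "\<lambda>y. y powr (a + 1) * lerch a y"])
         (use lerch_deriv[OF a ny] in \<open>auto simp: y_def intro!: derivative_eq_intros\<close>)
    have "((\<lambda>x. Ln x - binom_log a x + (1 - x) powr (a + 1) * lerch a (1 - x)) has_field_derivative
       inverse (of_real w) - (\<Sum>n. diffs (binom_log_coeff a) n * of_real w ^ n) + (y powr a / (1 - y)) * (- 1)) (at (of_real w))"
      by (intro DERIV_add DERIV_diff L binom_log_deriv nw has_field_derivative_Ln) (use w in auto)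
    also have "inverse (of_real w) - (\<Sum>n. diffs (binom_log_coeff a) n * of_real w ^ n) + (y powr a / (1 - y)) * (- 1) = 0"
    proof -
      define G where "G = (\<Sum>n. diffs (binom_log_coeff a) n * of_real w ^ n)"
      have "y powr a = 1 - of_real w * G" "1 - y = of_real w" "complex_of_real w \<noteq> 0"
        using binom_log_deriv_eq[OF nw, of a] w by (simp_all add: y_def G_def)
      thus ?thesis
        unfolding G_def[symmetric] by (simp add: divide_simps)
    qed
    finally have "((\<lambda>x. Ln x - binom_log a x + (1 - x) powr (a + 1) * lerch a (1 - x)) has_field_derivative 0) (at (of_real w))" .
    hence "((\<lambda>x::real. Ln x - binom_log a x + (1 - x) powr (a + 1) * lerch a (1 - x)) has_vector_derivative 0) (at w)"
      by (rule has_vector_derivative_real_field)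
    moreover have "\<forall>\<^sub>F x in nhds w. Ln (complex_of_real x) - binom_log a x + (1 - complex_of_real x) powr (a + 1) * lerch a (1 - x) = F x"
      using eventually_nhds_in_open[of "{0<..}" w] w
      by (auto simp: F_def Ln_of_real elim!: eventually_mono)
    ultimately show ?thesis
      by (subst (asm) has_vector_derivative_cong_ev[where g = F]) (auto dest: eventually_nhds_x_imp_x)
  qed
  have cst: "F x = F w" if "x \<in> {0<..<1}" for x
  proof -
    show ?thesis
      by (rule has_derivative_zero_unique_connected[of "{0<..<1}"])
         (use D that w in \<open>auto simp: has_vector_derivative_def\<close>)
  qed
  have "\<forall>\<^sub>F x::real in at_right 0. x \<in> {0<..<1}"
    by (rule eventually_at_right_real) simp
  hence "\<forall>\<^sub>F x in at_right 0. F x = F w"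
    using cst by (rule eventually_mono)
  hence "(F \<longlongrightarrow> F w) (at_right 0)"
    by (rule tendsto_eventually)
  moreover have "(F \<longlongrightarrow> - (euler_mascheroni + Digamma (a + 1))) (at_right 0)"
    unfolding F_def by (rule lerch_limit[OF a])
  ultimately have "F w = - (euler_mascheroni + Digamma (a + 1))"
    using tendsto_unique[OF trivial_limit_at_right_real] by blast
  thus ?thesis
    by (simp add: F_def algebra_simps)
qed

text \<open>
  Substitute \<open>t = u * w\<close> and use the primitive \<open>log w - binom_log a w\<close>. The connection formula rewrites its value
  at the upper end \<open>w = 1 - 1 / u\<close> in terms of the small quantity \<open>1 / u\<close>.
\<close>

lemma has_integral_power_over_t:
  fixes u :: real and a :: complex
  assumes a: "Re a \<ge> - 1 / 2" and u: "u \<ge> 2"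
  shows "((\<lambda>t. of_real (u - t) powr a / of_real t) has_integral
     of_real u powr a * (of_real (ln u) - euler_mascheroni - Digamma (a + 1) + binom_log a (1 / u)
        - (1 / u) powr (a + 1) * lerch a (1 / u))) {1..u - 1}"
proof -
  define H where "H w = Ln w - binom_log a w" for w
  have u0: "u > 0" using u by simp
  have D: "((\<lambda>t::real. of_real u powr a * H (of_real t / of_real u)) has_vector_derivative
      of_real (u - t) powr a / of_real t) (at t within {1..u - 1})" if t: "t \<in> {1..u - 1}" for t
  proof -
    define w where "w = complex_of_real t / of_real u"
    have wr: "w = of_real (t / u)" by (simp add: w_def)
    have nw: "norm w < 1" "w \<noteq> 0"
      using t u0 unfolding wr by (simp_all del: of_real_divide)
    have "t / u > 0" using t u0 by simp
    hence wp: "w \<notin> \<real>\<^sub>\<le>\<^sub>0" unfolding wr by (simp del: of_real_divide)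
    have dH: "(H has_field_derivative (1 - w) powr a / w) (at w)"
    proof -
      have "(H has_field_derivative inverse w - (\<Sum>n. diffs (binom_log_coeff a) n * w ^ n)) (at w)"
        unfolding H_def by (intro DERIV_diff binom_log_deriv nw has_field_derivative_Ln wp)
      also have "inverse w - (\<Sum>n. diffs (binom_log_coeff a) n * w ^ n) = (1 - w) powr a / w"
        using binom_log_deriv_eq[OF nw(1), of a] nw by (simp add: field_simps)
      finally show ?thesis .
    qed
    have "((\<lambda>x. of_real u powr a * H (x / of_real u)) has_field_derivative
       of_real u powr a * ((1 - w) powr a / w * (1 / of_real u))) (at (of_real t))"
      by (intro DERIV_cmult DERIV_chain2[where g = "\<lambda>x. x / of_real u" and f = H])
         (use dH u0 in \<open>auto simp: w_def intro!: derivative_eq_intros\<close>)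
    also have "of_real u powr a * ((1 - w) powr a / w * (1 / of_real u)) = of_real (u - t) powr a / of_real t"
    proof -
      have "complex_of_real (u - t) = of_real u * of_real (1 - t / u)"
        using u0 by (simp add: field_simps flip: of_real_mult)
      hence "complex_of_real (u - t) powr a = of_real u powr a * of_real (1 - t / u) powr a"
        using u0 t by (simp only:) (subst powr_times_real; simp del: of_real_diff of_real_divide)
      also have "complex_of_real (1 - t / u) = 1 - w" by (simp add: w_def)
      finally show ?thesis using u0 t by (simp add: w_def)
    qed
    finally have "((\<lambda>x::real. of_real u powr a * H (of_real x / of_real u)) has_vector_derivative
      of_real (u - t) powr a / of_real t) (at t)"
      by (rule has_vector_derivative_real_field)
    thus ?thesis by (rule has_vector_derivative_at_within)
  qed
  have I: "((\<lambda>t. of_real (u - t) powr a / of_real t) has_integral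
     (of_real u powr a * H (of_real (u - 1) / of_real u) - of_real u powr a * H (of_real 1 / of_real u))) {1..u - 1}"
    by (rule fundamental_theorem_of_calculus) (use u D in auto)
  have H1: "H (of_real 1 / of_real u) = - of_real (ln u) - binom_log a (1 / u)"
  proof -
    have "Ln (complex_of_real (1 / u)) = - of_real (ln u)"
      using u0 by (subst Ln_of_real) (auto simp: ln_div)
    thus ?thesis by (simp add: H_def)
  qed
  have H2: "H (of_real (u - 1) / of_real u) = 
      - (euler_mascheroni + Digamma (a + 1)) - (1 / u) powr (a + 1) * lerch a (1 / u)"
  proof -
    have "of_real (u - 1) / of_real u = complex_of_real (1 - 1 / u)"
      using u0 by (simp only: of_real_divide[symmetric]) (simp add: diff_divide_distrib)
    moreover have "H (complex_of_real (1 - 1 / u)) = of_real (ln (1 - 1 / u)) - binom_log a (complex_of_real (1 - 1 / u))"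
      unfolding H_def using u by (subst Ln_of_real) auto
    ultimately show ?thesis
      using binom_log_connection[OF a, of "1 - 1 / u"] u by simp
  qed
  show ?thesis
    by (rule has_integral_eq_rhs[OF I]) (simp add: H1 H2 algebra_simps del: of_real_divide of_real_1 of_real_diff)
qed

lemma norm_gbinomial_le:
  fixes a :: complex
  assumes "norm a \<le> real m"
  shows "norm (a gchoose n) \<le> real (m + n choose n)"
proof (induction n)
  case (Suc n)
  have e: "(a gchoose Suc n) = (a gchoose n) * ((a - of_nat n) / of_nat (Suc n))"
    using gbinomial_absorb_comp[of a n] gbinomial_absorption'[of "Suc n" a]
    by (simp add: gbinomial_mult_1' field_simps)
  have b: "real (m + Suc n choose Suc n) = real (m + n choose n) * ((real m + real n + 1) / real (Suc n))"
  proof -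
    have "Suc n * (Suc (m + n) choose Suc n) = Suc (m + n) * (m + n choose n)"
      by (rule Suc_times_binomial)
    hence "real (Suc n) * real (Suc (m + n) choose Suc n) = real (Suc (m + n)) * real (m + n choose n)"
      by (metis of_nat_mult)
    thus ?thesis by (simp add: field_simps)
  qed
  have "norm (a - of_nat n) \<le> real m + real n + 1"
    using norm_triangle_ineq4[of a "of_nat n"] assms unfolding norm_of_nat by linarith
  thus ?case
    unfolding e b norm_mult using Suc.IH
    by (intro mult_mono) (auto simp: norm_divide divide_right_mono simp del: of_nat_Suc)
qed simp

text \<open>
  The binomial coefficients of \<open>a\<close> grow at most like \<open>2\<^bsup>m+n\<^esup>\<close>, so \<open>\<bar>w\<bar> \<le> 1 / 4\<close> leaves a geometric series of
  ratio \<open>1 / 2\<close>.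
\<close>

lemma binom_log_tail_bound:
  assumes "norm a \<le> real m" "norm w \<le> 1 / 4"
  shows "norm (binom_log a w - (\<Sum>n\<le>k. binom_log_coeff a n * w ^ n)) \<le> 2 ^ (m + k + 2) * norm w ^ Suc k"
proof -
  have s: "summable (\<lambda>n. norm (binom_log_coeff a n * w ^ n))"
    using assms by (intro binom_log_summable_norm) auto
  have s': "summable (\<lambda>n. norm (binom_log_coeff a (n + Suc k) * w ^ (n + Suc k)))"
    using summable_ignore_initial_segment[OF s, of "Suc k"] .
  have "binom_log a w - (\<Sum>n\<le>k. binom_log_coeff a n * w ^ n) = (\<Sum>n. binom_log_coeff a (n + Suc k) * w ^ (n + Suc k))"
    unfolding binom_log_def
    using suminf_split_initial_segment[OF summable_norm_cancel[OF s], of "Suc k"] by (simp add: lessThan_Suc_atMost)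
  also have "norm \<dots> \<le> (\<Sum>n. norm (binom_log_coeff a (n + Suc k) * w ^ (n + Suc k)))"
    by (rule summable_norm[OF s'])
  also have "\<dots> \<le> (\<Sum>n. 2 ^ (m + k + 1) * norm w ^ Suc k * (1 / 2) ^ n)"
  proof (rule suminf_le[OF _ s'])
    fix n
    have "norm (binom_log_coeff a (n + Suc k)) \<le> norm (a gchoose (n + Suc k))"
      by (rule norm_binom_log_coeff_le)
    also have "\<dots> \<le> real (m + (n + Suc k) choose (n + Suc k))"
      by (rule norm_gbinomial_le[OF assms(1)])
    also have "\<dots> \<le> real (2 ^ (m + (n + Suc k)))"
      by (intro of_nat_mono binomial_le_pow2)
    finally have 1: "norm (binom_log_coeff a (n + Suc k)) \<le> 2 ^ (m + k + 1) * 2 ^ n"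
      by (simp add: power_add mult_ac)
    have "norm (w ^ (n + Suc k)) \<le> norm w ^ Suc k * (1 / 4) ^ n"
      using power_mono[OF assms(2), of n] 
      by (simp add: norm_power power_add norm_mult mult_ac mult_left_mono)
    with 1 have "norm (binom_log_coeff a (n + Suc k) * w ^ (n + Suc k)) \<le>
      (2 ^ (m + k + 1) * 2 ^ n) * (norm w ^ Suc k * (1 / 4) ^ n)"
      unfolding norm_mult[of _ "w ^ (n + Suc k)"] by (intro mult_mono) auto
    also have "\<dots> = 2 ^ (m + k + 1) * norm w ^ Suc k * (2 * (1 / 4)) ^ n"
      unfolding power_mult_distrib by (simp add: mult_ac)
    finally show "norm (binom_log_coeff a (n + Suc k) * w ^ (n + Suc k)) \<le> 2 ^ (m + k + 1) * norm w ^ Suc k * (1 / 2) ^ n"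
      by simp
  qed (auto intro!: summable_mult)
  also have "\<dots> = 2 ^ (m + k + 2) * norm w ^ Suc k"
    by (subst suminf_mult) (auto simp: suminf_geometric)
  finally show ?thesis .
qed

section \<open>Powers times polynomials in the logarithm, and their generating function\<close>

definition power_log :: "nat \<Rightarrow> nat \<Rightarrow> real \<Rightarrow> complex" where
  "power_log k j u =
     of_real (u ^ k) * (\<Sum>r\<le>j. (- 1) ^ r * C_coeff r k * of_real (ln u ^ (j - r)) / fact (j - r))"

text \<open>
  This is \<open>\<Sum>j. power_log k j u * x\<^bsup>j\<^esup>\<close>; see \<open>power_log_sums\<close>. The sign \<open>(- 1)\<^bsup>r\<^esup>\<close> in \<open>power_log\<close> comes from
  evaluating the generating function of the constants \<open>C\<close> at \<open>- x\<close>.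
\<close>

definition power_log_gen :: "nat \<Rightarrow> complex \<Rightarrow> real \<Rightarrow> complex" where
  "power_log_gen k x u =
     exp (- euler_mascheroni * x) * rGamma (of_nat k + x + 1) * of_real u powr (of_nat k + x)"

lemma C_coeff_abs_summable: "summable (\<lambda>r. norm (C_coeff r k * x ^ r))"
  by (rule powser_insidea[of _ "of_real (norm x + 1)"])
     (use C_coeff_sums sums_summable in blast, simp del: of_real_add)

lemma power_log_abs_summable:
  "summable (\<lambda>j. \<Sum>r\<le>j. norm (C_coeff r k * x ^ r) * norm ((x * of_real L) ^ (j - r) / fact (j - r)))"
proof (rule summable_Cauchy_product)
  show "summable (\<lambda>r. norm (norm (C_coeff r k * x ^ r)))"
    using C_coeff_abs_summable by simp
  show "summable (\<lambda>r. norm (norm ((x * of_real L) ^ r / fact r)))"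
    using summable_norm_exp[of "x * of_real L"] by (simp add: divide_inverse norm_mult norm_inverse mult_ac)
qed

lemma power_log_mult_power:
  "power_log k j u * x ^ j =
     of_real (u ^ k) * (\<Sum>r\<le>j. (C_coeff r k * (- x) ^ r) * ((x * of_real (ln u)) ^ (j - r) / fact (j - r)))"
  unfolding power_log_def sum_distrib_left sum_distrib_right mult.assoc
proof (intro sum.cong refl arg_cong[where f = "\<lambda>y. of_real (u ^ k) * y"])
  fix r assume "r \<in> {..j}"
  hence "x ^ j = x ^ r * x ^ (j - r)"
    by (simp flip: power_add)
  moreover have "(- x) ^ r = (- 1) ^ r * x ^ r"
    by (rule power_minus)
  ultimately show "(- 1) ^ r * (C_coeff r k * of_real (ln u ^ (j - r))) / fact (j - r) * x ^ j =
      C_coeff r k * ((- x) ^ r * ((x * of_real (ln u)) ^ (j - r) / fact (j - r)))"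
    by (simp add: power_mult_distrib)
qed

text \<open>
  A bound that is summable over \<open>j\<close> and uniform in \<open>u\<close>, as the Weierstrass test needs it to integrate the
  generating function term by term.
\<close>

lemma norm_power_log_le:
  assumes "1 \<le> u" "u \<le> U"
  shows "norm (power_log k j u * x ^ j) \<le>
    U ^ k * (\<Sum>r\<le>j. norm (C_coeff r k * x ^ r) * norm ((x * of_real (ln U)) ^ (j - r) / fact (j - r)))"
proof -
  have "norm (\<Sum>r\<le>j. (C_coeff r k * (- x) ^ r) * ((x * of_real (ln u)) ^ (j - r) / fact (j - r)))
     \<le> (\<Sum>r\<le>j. norm (C_coeff r k * x ^ r) * norm ((x * of_real (ln U)) ^ (j - r) / fact (j - r)))"
  proof (rule sum_norm_le)
    fix r assume "r \<in> {..j}"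
    have "\<bar>ln u\<bar> ^ (j - r) \<le> \<bar>ln U\<bar> ^ (j - r)"
      using assms by (intro power_mono) auto
    hence "norm ((x * of_real (ln u)) ^ (j - r) / fact (j - r)) \<le> norm ((x * of_real (ln U)) ^ (j - r) / fact (j - r))"
      by (simp add: norm_divide norm_power norm_mult power_mult_distrib divide_right_mono mult_left_mono)
    thus "norm ((C_coeff r k * (- x) ^ r) * ((x * of_real (ln u)) ^ (j - r) / fact (j - r)))
      \<le> norm (C_coeff r k * x ^ r) * norm ((x * of_real (ln U)) ^ (j - r) / fact (j - r))"
      unfolding norm_mult[of "C_coeff r k * _"]
      by (intro mult_mono) (auto simp: norm_mult norm_power)
  qed
  moreover have "u ^ k \<le> U ^ k"
    using assms by (intro power_mono) auto
  ultimately show ?thesis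
    unfolding power_log_mult_power norm_mult[of "of_real (u ^ k)"]
    using assms by (intro mult_mono) (auto simp: sum_nonneg norm_power)
qed

lemma power_log_sums:
  assumes u: "u > 0"
  shows "(\<lambda>j. power_log k j u * x ^ j) sums power_log_gen k x u"
proof -
  define a where "a r = C_coeff r k * (- x) ^ r" for r
  define b where "b i = (x * of_real (ln u)) ^ i / fact i" for i
  have "summable (\<lambda>r. norm (a r))"
    unfolding a_def by (rule C_coeff_abs_summable)
  moreover have "summable (\<lambda>i. norm (b i))"
    unfolding b_def using summable_norm_exp[of "x * of_real (ln u)"]
    by (simp add: divide_inverse norm_mult norm_inverse mult_ac)
  ultimately have "(\<lambda>j. \<Sum>r\<le>j. a r * b (j - r)) sums (suminf a * suminf b)"
    by (rule Cauchy_product_sums)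
  hence "(\<lambda>j. of_real (u ^ k) * (\<Sum>r\<le>j. a r * b (j - r))) sums (of_real (u ^ k) * (suminf a * suminf b))"
    by (rule sums_mult)
  also have "(\<lambda>j. of_real (u ^ k) * (\<Sum>r\<le>j. a r * b (j - r))) = (\<lambda>j. power_log k j u * x ^ j)"
    by (simp add: power_log_mult_power a_def b_def)
  also have "suminf a = exp (- euler_mascheroni * x) * rGamma (of_nat k + x + 1)"
    using C_coeff_sums[of k "- x"] by (simp add: a_def[abs_def] sums_iff add_ac)
  also have "suminf b = exp (x * of_real (ln u))"
    using exp_converges[of "x * of_real (ln u)"] by (simp add: b_def[abs_def] sums_iff scaleR_conv_of_real divide_inverse mult_ac)
  also have "of_real (u ^ k) * (exp (- euler_mascheroni * x) * rGamma (of_nat k + x + 1) * exp (x * of_real (ln u))) =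
      power_log_gen k x u"
    using u by (simp add: power_log_gen_def powr_add powr_def[of _ x] Ln_of_real mult_ac)
  finally show ?thesis .
qed

text \<open>
  Raising \<open>j\<close> is differentiation of the generating function in \<open>x\<close>. The logarithmic derivative of
  \<open>exp (- \<gamma> * x) * u\<^bsup>x\<^esup> / \<Gamma> (k + x + 1)\<close> is \<open>log u - \<gamma> - \<psi> (k + x + 1)\<close>, the constant part of the integral in
  \<open>has_integral_power_over_t\<close>.
\<close>

lemma power_log_Suc_sums:
  assumes u: "u > 0" and x: "Re x > - 1"
  shows "(\<lambda>j. of_nat (Suc j) * power_log k (Suc j) u * x ^ j) sums
           (power_log_gen k x u * (of_real (ln u) - euler_mascheroni - Digamma (of_nat k + x + 1)))"
proof -
  have s: "summable (\<lambda>j. power_log k j u * z ^ j)" for z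
    using power_log_sums[OF u] sums_summable by blast
  have "((\<lambda>z. \<Sum>j. power_log k j u * z ^ j) has_field_derivative
          (\<Sum>j. diffs (\<lambda>j. power_log k j u) j * x ^ j)) (at x)"
    by (rule termdiffs_strong_converges_everywhere[OF s])
  also have "(\<lambda>z. \<Sum>j. power_log k j u * z ^ j) = (\<lambda>z. power_log_gen k z u)"
    using power_log_sums[OF u] by (simp add: sums_iff)
  finally have D1: "((\<lambda>z. power_log_gen k z u) has_field_derivative
      (\<Sum>j. diffs (\<lambda>j. power_log k j u) j * x ^ j)) (at x)" .
  have np: "of_nat k + x + 1 \<notin> \<int>\<^sub>\<le>\<^sub>0"
  proof
    assume "of_nat k + x + 1 \<in> \<int>\<^sub>\<le>\<^sub>0"
    then obtain n where "of_nat k + x + 1 = - of_nat n"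
      by (auto elim!: nonpos_Ints_cases')
    from arg_cong[OF this, of Re] x show False by simp
  qed
  have D2: "((\<lambda>z. power_log_gen k z u) has_field_derivative
      power_log_gen k x u * (of_real (ln u) - euler_mascheroni - Digamma (of_nat k + x + 1))) (at x)"
    unfolding power_log_gen_def using u np
    by (auto intro!: derivative_eq_intros simp: powr_def Ln_of_real algebra_simps)
  have "summable (\<lambda>j. diffs (\<lambda>j. power_log k j u) j * x ^ j)"
    by (rule termdiff_converges[of _ "norm x + 1"]) (use s in auto)
  hence "(\<lambda>j. diffs (\<lambda>j. power_log k j u) j * x ^ j) sums (\<Sum>j. diffs (\<lambda>j. power_log k j u) j * x ^ j)"
    by (rule summable_sums)
  also have "(\<Sum>j. diffs (\<lambda>j. power_log k j u) j * x ^ j) =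
       power_log_gen k x u * (of_real (ln u) - euler_mascheroni - Digamma (of_nat k + x + 1))"
    by (rule DERIV_unique[OF D1 D2])
  finally show ?thesis
    by (simp add: diffs_def)
qed

lemma continuous_on_power_log: "continuous_on {0<..} (power_log k j)"
  unfolding power_log_def by (intro continuous_intros) auto

lemma continuous_on_power_log_over_t:
  "continuous_on {1..u - 1} (\<lambda>t. power_log k j (u - t) / of_real t)"
  by (intro continuous_intros continuous_on_compose2[OF continuous_on_power_log]) auto

lemma power_log_integral_sums:
  "(\<lambda>j. integral {1..u - 1} (\<lambda>t. power_log k j (u - t) / of_real t) * x ^ j) sums
     integral {1..u - 1} (\<lambda>t. power_log_gen k x (u - t) / of_real t)"
proof -
  define M where "M j = u ^ k * (\<Sum>r\<le>j. norm (C_coeff r k * x ^ r) * norm ((x * of_real (ln u)) ^ (j - r) / fact (j - r)))" for j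
  define f where "f N t = (\<Sum>j<N. power_log k j (u - t) / of_real t * x ^ j)" for N t
  have M: "norm (power_log k j (u - t) / of_real t * x ^ j) \<le> M j" if "t \<in> {1..u - 1}" for j t
  proof -
    have "norm (power_log k j (u - t) / of_real t * x ^ j) = norm (power_log k j (u - t) * x ^ j) / t"
      using that by (simp add: norm_mult norm_divide)
    also have "\<dots> \<le> norm (power_log k j (u - t) * x ^ j) / 1"
      using that by (intro divide_left_mono) auto
    also have "\<dots> \<le> M j"
      unfolding M_def using norm_power_log_le[of "u - t" u k j x] that by simp
    finally show ?thesis .
  qed
  have sM: "summable M"
    unfolding M_def by (intro summable_mult power_log_abs_summable)
  have ul: "uniform_limit {1..u - 1} f (\<lambda>t. \<Sum>j. power_log k j (u - t) / of_real t * x ^ j) sequentially"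
    unfolding f_def by (rule Weierstrass_m_test[OF M sM])
  have c: "continuous_on {1..u - 1} (f N)" for N
    unfolding f_def by (intro continuous_on_sum continuous_on_mult continuous_on_power_log_over_t continuous_on_const)
  obtain I J where IJ: "\<And>N. (f N has_integral I N) {1..u - 1}"
      "((\<lambda>t. \<Sum>j. power_log k j (u - t) / of_real t * x ^ j) has_integral J) {1..u - 1}" "I \<longlonglongrightarrow> J"
    using uniform_limit_integral[OF ul c] by auto
  have "I N = (\<Sum>j<N. integral {1..u - 1} (\<lambda>t. power_log k j (u - t) / of_real t) * x ^ j)" for N
  proof -
    have "(f N has_integral (\<Sum>j<N. integral {1..u - 1} (\<lambda>t. power_log k j (u - t) / of_real t) * x ^ j)) {1..u - 1}"
      unfolding f_def
      by (intro has_integral_sum has_integral_mult_left integrable_integral integrable_continuous_real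
                continuous_on_power_log_over_t) auto
    with IJ(1) show ?thesis
      using has_integral_unique by blast
  qed
  hence "I = (\<lambda>N. \<Sum>j<N. integral {1..u - 1} (\<lambda>t. power_log k j (u - t) / of_real t) * x ^ j)"
    by auto
  moreover have "J = integral {1..u - 1} (\<lambda>t. power_log_gen k x (u - t) / of_real t)"
  proof -
    have "((\<lambda>t. power_log_gen k x (u - t) / of_real t) has_integral J) {1..u - 1}"
    proof (rule has_integral_eq[OF _ IJ(2)])
      fix t assume "t \<in> {1..u - 1}"
      hence "(\<lambda>j. power_log k j (u - t) * x ^ j / of_real t) sums (power_log_gen k x (u - t) / of_real t)"
        by (intro sums_divide power_log_sums) auto
      thus "(\<Sum>j. power_log k j (u - t) / of_real t * x ^ j) = power_log_gen k x (u - t) / of_real t"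
        by (simp add: sums_iff)
    qed
    thus ?thesis by (simp add: integral_unique)
  qed
  ultimately show ?thesis
    using IJ(3) by (simp add: sums_def)
qed

section \<open>Convolution with 1/t acts as multiplication by the exponential integral\<close>

text \<open>
  Lowering \<open>k\<close> by \<open>i\<close> multiplies \<open>u\<^bsup>a\<^esup> / \<Gamma> (a + 1)\<close> by \<open>u\<^bsup>-i\<^esup>\<close> and the falling factorial \<open>i! * (a gchoose i)\<close>; the
  factor \<open>i!\<close> cancels against the one in \<open>E_coeff i 1\<close>.
\<close>

lemma E_coeff_power_log_gen:
  assumes i: "i \<le> k" and u: "u > 0"
  shows "E_coeff i 1 * power_log_gen (k - i) x u =
           power_log_gen k x u * (binom_log_coeff (of_nat k + x) i * of_real (1 / u) ^ i)"
proof -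
  define a where "a = of_nat k + x"
  have a: "of_nat (k - i) + x = a - of_nat i"
    using i by (simp add: a_def of_nat_diff)
  have "rGamma (a - of_nat i + 1) = pochhammer (a - of_nat i + 1) i * rGamma (a + 1)"
    by (subst pochhammer_rGamma[of _ i]) (simp add: algebra_simps)
  also have "pochhammer (a - of_nat i + 1) i = fact i * (a gchoose i)"
    by (simp add: gbinomial_pochhammer')
  finally have r: "rGamma (of_nat (k - i) + x + 1) = fact i * (a gchoose i) * rGamma (a + 1)"
    by (simp add: a)
  have p: "of_real u powr (of_nat (k - i) + x) = of_real u powr a * of_real (1 / u) ^ i"
    unfolding a using u by (simp add: powr_diff power_divide power_one_over)
  show ?thesis
    unfolding power_log_gen_def r p a_def[symmetric] E_coeff_one binom_log_coeff_def
    by (simp add: divide_simps)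
qed

text \<open>
  Cauchy's inequality needs a closed disc on which \<open>f\<close> is continuous; \<open>\<rho> / 2\<close> is a convenient radius inside the
  disc of convergence.
\<close>

lemma power_series_coeff_bound:
  fixes f :: "complex \<Rightarrow> complex"
  assumes "\<rho> > 0"
    and f: "\<And>x. norm x < \<rho> \<Longrightarrow> (\<lambda>j. c j * x ^ j) sums f x"
    and B: "\<And>x. norm x < \<rho> \<Longrightarrow> norm (f x) \<le> B"
  shows "norm (c n) \<le> B / (\<rho> / 2) ^ n"
proof -
  have h: "f holomorphic_on ball 0 \<rho>"
    by (rule power_series_holomorphic[where a = c]) (use f in auto)
  have "f has_fps_expansion Abs_fps c"
    using eventually_nhds_in_open[of "ball 0 \<rho>" "0::complex"] assms
    by (intro has_fps_expansionI) (auto elim!: eventually_mono)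
  from fps_nth_fps_expansion[OF this, of n] have c: "c n = (deriv ^^ n) f 0 / fact n"
    by simp
  have "norm ((deriv ^^ n) f 0) \<le> fact n * B / (\<rho> / 2) ^ n"
  proof (rule Cauchy_inequality)
    show "f holomorphic_on ball 0 (\<rho> / 2)"
      by (rule holomorphic_on_subset[OF h]) (use assms in auto)
    show "continuous_on (cball 0 (\<rho> / 2)) f"
      by (rule continuous_on_subset[OF holomorphic_on_imp_continuous_on[OF h]]) (use assms in auto)
  qed (use assms in auto)
  hence "norm ((deriv ^^ n) f 0) / fact n \<le> (fact n * B / (\<rho> / 2) ^ n) / fact n"
    by (intro divide_right_mono) auto
  thus ?thesis
    by (simp add: c norm_divide)
qed

text \<open>
  The integral stops at \<open>u - 1\<close>, so that \<open>power_log k j\<close> is only used on \<open>[1, \<infinity>)\<close>, away from its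
  singularity at 0.
\<close>

definition convolution_defect :: "nat \<Rightarrow> nat \<Rightarrow> real \<Rightarrow> complex" where
  "convolution_defect k j u = integral {1..u - 1} (\<lambda>t. power_log k j (u - t) / of_real t)
     - of_nat (Suc j) * power_log k (Suc j) u - (\<Sum>i\<le>k. E_coeff i 1 * power_log (k - i) j u)"

text \<open>
  The logarithm and the digamma value cancel by \<open>power_log_Suc_sums\<close>, and the terms of \<open>binom_log\<close> up to the index \<open>k\<close> by
  \<open>E_coeff_power_log_gen\<close>. A tail of \<open>binom_log\<close> and the Lerch term remain.
\<close>

lemma convolution_defect_sums:
  fixes u :: real
  assumes u: "u \<ge> 2" and x: "Re x \<ge> - 1 / 2"
  shows "(\<lambda>j. convolution_defect k j u * x ^ j) sums
     (power_log_gen k x u * (binom_log (of_nat k + x) (of_real (1 / u))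
        - (\<Sum>i\<le>k. binom_log_coeff (of_nat k + x) i * of_real (1 / u) ^ i)
        - of_real (1 / u) powr (of_nat k + x + 1) * lerch (of_nat k + x) (of_real (1 / u))))"
proof -
  define a where "a = of_nat k + x"
  have u0: "u > 0" using u by simp
  have a: "Re a \<ge> - 1 / 2" using x by (simp add: a_def)
  have "((\<lambda>t. exp (- euler_mascheroni * x) * rGamma (a + 1) * (of_real (u - t) powr a / of_real t)) has_integral
     exp (- euler_mascheroni * x) * rGamma (a + 1) * 
     (of_real u powr a * (of_real (ln u) - euler_mascheroni - Digamma (a + 1) + binom_log a (1 / u)
        - (1 / u) powr (a + 1) * lerch a (1 / u)))) {1..u - 1}"
    by (rule has_integral_mult_right[OF has_integral_power_over_t[OF a u]])
  hence I: "integral {1..u - 1} (\<lambda>t. power_log_gen k x (u - t) / of_real t) = 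
     power_log_gen k x u * (of_real (ln u) - euler_mascheroni - Digamma (a + 1) + binom_log a (1 / u)
        - (1 / u) powr (a + 1) * lerch a (1 / u))"
    unfolding power_log_gen_def a_def[symmetric] by (simp add: integral_unique mult_ac)
  have "(\<lambda>j. \<Sum>i\<le>k. E_coeff i 1 * (power_log (k - i) j u * x ^ j)) sums
          (\<Sum>i\<le>k. E_coeff i 1 * power_log_gen (k - i) x u)"
    by (intro sums_sum sums_mult power_log_sums u0)
  also have "(\<Sum>i\<le>k. E_coeff i 1 * power_log_gen (k - i) x u) =
      power_log_gen k x u * (\<Sum>i\<le>k. binom_log_coeff a i * of_real (1 / u) ^ i)"
    unfolding sum_distrib_left a_def by (intro sum.cong E_coeff_power_log_gen u0) auto
  finally have E: "(\<lambda>j. \<Sum>i\<le>k. E_coeff i 1 * (power_log (k - i) j u * x ^ j)) sums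
      (power_log_gen k x u * (\<Sum>i\<le>k. binom_log_coeff a i * of_real (1 / u) ^ i))" .
  have x1: "Re x > - 1" using x by simp
  have "(\<lambda>j. integral {1..u - 1} (\<lambda>t. power_log k j (u - t) / of_real t) * x ^ j
          - of_nat (Suc j) * power_log k (Suc j) u * x ^ j
          - (\<Sum>i\<le>k. E_coeff i 1 * (power_log (k - i) j u * x ^ j))) sums
        (power_log_gen k x u * (of_real (ln u) - euler_mascheroni - Digamma (a + 1) + binom_log a (1 / u)
            - (1 / u) powr (a + 1) * lerch a (1 / u))
         - power_log_gen k x u * (of_real (ln u) - euler_mascheroni - Digamma (a + 1))
         - power_log_gen k x u * (\<Sum>i\<le>k. binom_log_coeff a i * of_real (1 / u) ^ i))"
    using power_log_integral_sums[where k = k and u = u and x = x] power_log_Suc_sums[OF u0 x1, of k]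
    unfolding I a_def[symmetric] by (intro sums_diff E)
  also have "(\<lambda>j. integral {1..u - 1} (\<lambda>t. power_log k j (u - t) / of_real t) * x ^ j
          - of_nat (Suc j) * power_log k (Suc j) u * x ^ j
          - (\<Sum>i\<le>k. E_coeff i 1 * (power_log (k - i) j u * x ^ j))) =
       (\<lambda>j. convolution_defect k j u * x ^ j)"
    unfolding convolution_defect_def
    by (simp add: left_diff_distrib sum_distrib_right mult.assoc)
  finally show ?thesis
    unfolding a_def[symmetric] by (simp add: algebra_simps)
qed

text \<open>
  The tail of \<open>binom_log\<close> is \<open>O(u\<^bsup>-k-1\<^esup>)\<close> and the Lerch term is \<open>O(u\<^bsup>-a-1\<^esup>)\<close>. Both are multiplied by \<open>u\<^bsup>a\<^esup>\<close>
  with \<open>a = k + x\<close>, so they are \<open>O(1 / u)\<close> as long as \<open>u\<^bsup>x\<^esup>\<close> is bounded. The radius \<open>1 / (2 * log (e * u))\<close> is the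
  largest order of magnitude for which this holds, and its \<open>j\<close>-th power produces the factor \<open>log\<^bsup>j\<^esup> (e * u)\<close>.
\<close>

lemma convolution_defect_bound:
  "\<exists>A\<ge>0. \<forall>u\<ge>4. norm (convolution_defect k j u) \<le> A * (ln (exp 1 * u) ^ j / u)"
proof -
  have "continuous_on (cball 0 (1 / 2)) (\<lambda>x. exp (- euler_mascheroni * x) * rGamma (of_nat k + x + 1 :: complex))"
    by (intro continuous_on_mult continuous_on_compose2[OF continuous_on_rGamma[of UNIV]] continuous_intros) auto
  hence "compact ((\<lambda>x. exp (- euler_mascheroni * x) * rGamma (of_nat k + x + 1 :: complex)) ` cball 0 (1 / 2))"
    by (rule compact_continuous_image) simp
  then obtain G where "\<forall>y \<in> (\<lambda>x. exp (- euler_mascheroni * x) * rGamma (of_nat k + x + 1 :: complex)) ` cball 0 (1 / 2).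
      norm y \<le> G"
    using compact_imp_bounded bounded_iff by meson
  hence G: "norm (exp (- euler_mascheroni * x) * rGamma (of_nat k + x + 1)) \<le> G" if "norm x \<le> 1 / 2" for x :: complex
    using that by (simp add: mem_cball_0)
  have G0: "G \<ge> 0"
    using order_trans[OF norm_ge_zero G[of 0]] by simp
  define A where "A = G * (exp 1 * 2 ^ (2 * k + 3) + 4)"
  have A0: "A \<ge> 0" using G0 by (simp add: A_def)
  have main: "norm (convolution_defect k j u) \<le> A * 4 ^ j * (ln (exp 1 * u) ^ j / u)" if u: "u \<ge> 4" for u
  proof -
    define L where "L = ln (exp 1 * u)"
    have L: "L = 1 + ln u"
      using u by (simp add: L_def ln_mult)
    have lnu: "ln u \<ge> 0" using u by simp
    define \<rho> where "\<rho> = 1 / (2 * L)"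
    have \<rho>: "\<rho> > 0" "\<rho> \<le> 1 / 2" "\<rho> * ln u \<le> 1"
      using lnu by (auto simp: \<rho>_def L divide_simps)
    have "norm (convolution_defect k j u) \<le> (A / u) / (\<rho> / 2) ^ j"
    proof (rule power_series_coeff_bound[OF \<rho>(1)])
      fix x :: complex assume x: "norm x < \<rho>"
      have rx: "\<bar>Re x\<bar> \<le> norm x" by (rule abs_Re_le_cmod)
      have x2: "Re x \<ge> - 1 / 2" "norm x \<le> 1 / 2" using rx x \<rho> by auto
      define a where "a = of_nat k + x"
      have a: "Re a \<ge> - 1 / 2" using x2 by (simp add: a_def)
      have na: "norm a \<le> real (k + 1)"
        using norm_triangle_ineq[of "of_nat k" x] x2 by (simp add: a_def)
      let ?w = "complex_of_real (1 / u)"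
      have nw: "norm ?w = 1 / u" using u by (simp add: norm_divide)
      have nw4: "norm ?w \<le> 1 / 4" unfolding nw using u by (simp add: field_simps)
      let ?R = "power_log_gen k x u * (binom_log a ?w - (\<Sum>i\<le>k. binom_log_coeff a i * ?w ^ i)
          - ?w powr (a + 1) * lerch a ?w)"
      show "(\<lambda>j. convolution_defect k j u * x ^ j) sums ?R"
        unfolding a_def by (rule convolution_defect_sums) (use u x2 in auto)
      \<comment> \<open>\<open>\<bar>x\<bar> * log u \<le> \<rho> * log u \<le> 1\<close> by the choice of \<open>\<rho>\<close>.\<close>
      have upx: "u powr Re x \<le> exp 1"
      proof -
        have "Re x * ln u \<le> \<rho> * ln u"
          using rx x lnu by (intro mult_right_mono) auto
        from order_trans[OF this \<rho>(3)] show ?thesis using u by (simp add: powr_def)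
      qed
      have nua: "norm (complex_of_real u powr a) = u ^ k * u powr Re x"
      proof -
        have "norm (complex_of_real u powr a) = u powr (real k + Re x)"
          using u by (subst norm_powr_real_powr) (auto simp: a_def)
        thus ?thesis using u by (simp add: powr_add powr_realpow)
      qed
      have nw1: "norm (complex_of_real u powr a) * norm (?w powr (a + 1)) = 1 / u"
      proof -
        have "norm (?w powr (a + 1)) = (1 / u) powr (Re a + 1)"
          using u by (subst norm_powr_real_powr) auto
        also have "\<dots> = u powr (- (Re a + 1))"
          unfolding powr_minus_divide using u by (simp add: powr_divide)
        finally have 1: "norm (?w powr (a + 1)) = u powr (- (Re a + 1))" .
        have "norm (complex_of_real u powr a) = u powr Re a"
          using u by (subst norm_powr_real_powr) auto
        hence "norm (complex_of_real u powr a) * norm (?w powr (a + 1)) = u powr (Re a + - (Re a + 1))"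
          unfolding 1 by (simp only: powr_add)
        also have "\<dots> = 1 / u"
          using u by (simp add: powr_minus_divide)
        finally show ?thesis .
      qed
      have t1: "norm (complex_of_real u powr a) * norm (binom_log a ?w - (\<Sum>i\<le>k. binom_log_coeff a i * ?w ^ i))
          \<le> exp 1 * 2 ^ (2 * k + 3) / u"
      proof -
        have "norm (binom_log a ?w - (\<Sum>i\<le>k. binom_log_coeff a i * ?w ^ i)) \<le> 2 ^ ((k + 1) + k + 2) * norm ?w ^ Suc k"
          by (rule binom_log_tail_bound[OF na]) (rule nw4)
        also have "\<dots> = 2 ^ (2 * k + 3) / (u ^ k * u)"
        proof -
          have "(k + 1) + k + 2 = 2 * k + 3" by simp
          thus ?thesis unfolding nw by (simp only: power_divide power_Suc2 power_one mult_1 times_divide_eq_right mult_1_right divide_divide_eq_left)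
        qed
        finally have "norm (complex_of_real u powr a) * norm (binom_log a ?w - (\<Sum>i\<le>k. binom_log_coeff a i * ?w ^ i))
            \<le> (u ^ k * exp 1) * (2 ^ (2 * k + 3) / (u ^ k * u))"
          unfolding nua using upx u by (intro mult_mono) auto
        also have "\<dots> = exp 1 * 2 ^ (2 * k + 3) / u"
          using u by simp
        finally show ?thesis .
      qed
      have t2: "norm (complex_of_real u powr a) * norm (?w powr (a + 1) * lerch a ?w) \<le> 4 / u"
      proof -
        have "norm (complex_of_real u powr a) * norm (?w powr (a + 1) * lerch a ?w) =
            (norm (complex_of_real u powr a) * norm (?w powr (a + 1))) * norm (lerch a ?w)"
          by (simp only: norm_mult mult.assoc)
        also have "\<dots> = 1 / u * norm (lerch a ?w)"
          by (simp only: nw1)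
        also have "\<dots> \<le> 1 / u * 4"
          using u nw4 by (intro mult_left_mono norm_lerch_le a) auto
        finally show ?thesis by simp
      qed
      have "norm ?R = norm (exp (- euler_mascheroni * x) * rGamma (of_nat k + x + 1)) *
         (norm (complex_of_real u powr a) * norm (binom_log a ?w - (\<Sum>i\<le>k. binom_log_coeff a i * ?w ^ i)
          - ?w powr (a + 1) * lerch a ?w))"
        unfolding power_log_gen_def a_def[symmetric] by (simp only: norm_mult mult.assoc)
      also have "\<dots> \<le> G * (exp 1 * 2 ^ (2 * k + 3) / u + 4 / u)"
      proof (intro mult_mono G x2 G0)
        have "norm (complex_of_real u powr a) * norm (binom_log a ?w - (\<Sum>i\<le>k. binom_log_coeff a i * ?w ^ i)
          - ?w powr (a + 1) * lerch a ?w) \<le> norm (complex_of_real u powr a) * 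
          (norm (binom_log a ?w - (\<Sum>i\<le>k. binom_log_coeff a i * ?w ^ i)) + norm (?w powr (a + 1) * lerch a ?w))"
          by (intro mult_left_mono norm_triangle_ineq4) auto
        also have "\<dots> \<le> exp 1 * 2 ^ (2 * k + 3) / u + 4 / u"
          unfolding distrib_left by (intro add_mono t1 t2)
        finally show "norm (complex_of_real u powr a) * norm (binom_log a ?w - (\<Sum>i\<le>k. binom_log_coeff a i * ?w ^ i)
          - ?w powr (a + 1) * lerch a ?w) \<le> exp 1 * 2 ^ (2 * k + 3) / u + 4 / u" .
      qed auto
      also have "\<dots> = A / u"
        by (simp only: A_def add_divide_distrib[symmetric] times_divide_eq_right)
      finally show "norm ?R \<le> A / u" .
    qed
    also have "\<dots> = A * 4 ^ j * (L ^ j / u)"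
    proof -
      have "\<rho> / 2 = 1 / (4 * L)"
        by (simp add: \<rho>_def)
      thus ?thesis
        by (simp add: power_divide power_mult_distrib)
    qed
    finally show ?thesis by (simp add: L_def)
  qed
  show ?thesis
    by (rule exI[of _ "A * 4 ^ j"]) (use A0 main in auto)
qed

section \<open>The functions K as iterated convolutions\<close>

text \<open>
  \<open>l!\<close> times the function \<open>K\<close>, by \<open>K_eq_iter_conv\<close>. At \<open>l = 0\<close> the support is \<open>u \<ge> 0\<close> and not \<open>u > 0\<close>, to agree with
  the closed condition \<open>t\<^sub>1 + \<dots> + t\<^sub>l \<le> u\<close> in the integral for every \<open>u\<close>.
\<close>

primrec iter_conv :: "nat \<Rightarrow> nat \<Rightarrow> real \<Rightarrow> real" where
  "iter_conv \<kappa> 0 u = (if 0 \<le> u then u ^ \<kappa> else 0)"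
| "iter_conv \<kappa> (Suc l) u = (LINT t : {1..u} | lborel. iter_conv \<kappa> l (u - t) / t)"

lemma iter_conv_neg: "u < 0 \<Longrightarrow> iter_conv \<kappa> l u = 0"
  by (cases l) (auto simp: set_lebesgue_integral_def)

text \<open>
  The three properties are proved together because measurability and the bound at level \<open>l\<close> give the
  integrability that the bound at level \<open>l + 1\<close> needs.
\<close>

lemma iter_conv_props:
  "iter_conv \<kappa> l \<in> borel_measurable borel \<and> (\<forall>u. 0 \<le> iter_conv \<kappa> l u \<and> iter_conv \<kappa> l u \<le> max 0 u ^ (\<kappa> + l)) \<and>
   (\<forall>u. set_integrable lborel {1..u} (\<lambda>t. iter_conv \<kappa> l (u - t) / t))"
proof (induction l)
  have integrable: "set_integrable lborel {1..u} (\<lambda>t. f (u - t) / t)"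
    if [measurable]: "f \<in> borel_measurable borel" and f: "\<forall>u. 0 \<le> f u \<and> f u \<le> max 0 u ^ m"
    for f :: "real \<Rightarrow> real" and m u
  proof -
    have "integrable lborel (\<lambda>t. indicator {1..u} t *\<^sub>R (max 0 u ^ m))"
      by (auto simp: integrable_indicator_iff emeasure_lborel_Icc_eq)
    thus ?thesis
      unfolding set_integrable_def
    proof (rule Bochner_Integration.integrable_bound)
      show "AE t in lborel. norm (indicator {1..u} t *\<^sub>R (f (u - t) / t)) \<le> norm (indicator {1..u} t *\<^sub>R (max 0 u ^ m))"
      proof (rule AE_I2)
        fix t
        have "f (u - t) / t \<le> max 0 u ^ m" "f (u - t) \<ge> 0" if t: "t \<in> {1..u}"
        proof -
          have "f (u - t) / t \<le> f (u - t) / 1"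
            using t f by (intro divide_left_mono) auto
          also have "\<dots> \<le> max 0 (u - t) ^ m"
            using f by simp
          also have "\<dots> \<le> max 0 u ^ m"
            using t by (intro power_mono) auto
          finally show "f (u - t) / t \<le> max 0 u ^ m" .
        qed (use f in auto)
        thus "norm (indicator {1..u} t *\<^sub>R (f (u - t) / t)) \<le> norm (indicator {1..u} t *\<^sub>R (max 0 u ^ m))"
          by (auto simp: indicator_def)
      qed
    qed measurable
  qed
  {
    case 0
    have 1: "iter_conv \<kappa> 0 \<in> borel_measurable borel"
      unfolding iter_conv.simps[abs_def] by measurable
    have 2: "\<forall>u. 0 \<le> iter_conv \<kappa> 0 u \<and> iter_conv \<kappa> 0 u \<le> max 0 u ^ (\<kappa> + 0)"
      by auto
    show ?case
      using 1 2 integrable[OF 1 2] by blast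
  next
    case (Suc l)
    hence [measurable]: "iter_conv \<kappa> l \<in> borel_measurable borel"
      and b: "\<And>u. 0 \<le> iter_conv \<kappa> l u" "\<And>u. iter_conv \<kappa> l u \<le> max 0 u ^ (\<kappa> + l)"
      and i: "\<And>u. set_integrable lborel {1..u} (\<lambda>t. iter_conv \<kappa> l (u - t) / t)"
      by auto
    have 1: "iter_conv \<kappa> (Suc l) \<in> borel_measurable borel"
    proof -
      have "iter_conv \<kappa> (Suc l) = (\<lambda>u. LINT t | lborel. (if 1 \<le> t \<and> t \<le> u then 1 else 0) *\<^sub>R (iter_conv \<kappa> l (u - t) / t))"
        unfolding iter_conv.simps[abs_def] set_lebesgue_integral_def
        by (intro ext Bochner_Integration.integral_cong) (auto simp: indicator_def)
      also have "\<dots> \<in> borel_measurable borel"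
        by measurable
      finally show ?thesis .
    qed
    have 2: "\<forall>u. 0 \<le> iter_conv \<kappa> (Suc l) u \<and> iter_conv \<kappa> (Suc l) u \<le> max 0 u ^ (\<kappa> + Suc l)"
    proof (intro allI conjI)
      fix u :: real
      show "0 \<le> iter_conv \<kappa> (Suc l) u"
        unfolding iter_conv.simps set_lebesgue_integral_def
        by (rule Bochner_Integration.integral_nonneg) (use b in \<open>auto simp: indicator_def\<close>)
      have "iter_conv \<kappa> (Suc l) u \<le> (LINT t : {1..u} | lborel. max 0 u ^ (\<kappa> + l))"
        unfolding iter_conv.simps
      proof (rule set_integral_mono[OF i])
        show "set_integrable lborel {1..u} (\<lambda>t. max 0 u ^ (\<kappa> + l))"
          unfolding set_integrable_def by (auto simp: integrable_indicator_iff emeasure_lborel_Icc_eq)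
        fix t assume t: "t \<in> {1..u}"
        have "iter_conv \<kappa> l (u - t) / t \<le> iter_conv \<kappa> l (u - t) / 1"
          using t b by (intro divide_left_mono) auto
        also have "\<dots> \<le> max 0 (u - t) ^ (\<kappa> + l)"
          using b by simp
        also have "\<dots> \<le> max 0 u ^ (\<kappa> + l)"
          using t by (intro power_mono) auto
        finally show "iter_conv \<kappa> l (u - t) / t \<le> max 0 u ^ (\<kappa> + l)" .
      qed
      also have "\<dots> = max 0 (u - 1) * max 0 u ^ (\<kappa> + l)"
        by (simp add: set_lebesgue_integral_def measure_def emeasure_lborel_Icc_eq max_def)
      also have "\<dots> \<le> max 0 u * max 0 u ^ (\<kappa> + l)"
        by (intro mult_right_mono) auto
      finally show "iter_conv \<kappa> (Suc l) u \<le> max 0 u ^ (\<kappa> + Suc l)"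
        by simp
    qed
    show ?case
      using 1 2 integrable[OF 1 2] by blast
  }
qed

lemma iter_conv_measurable [measurable]: "iter_conv \<kappa> l \<in> borel_measurable borel"
  and iter_conv_nonneg: "0 \<le> iter_conv \<kappa> l u"
  and iter_conv_le: "iter_conv \<kappa> l u \<le> max 0 u ^ (\<kappa> + l)"
  and iter_conv_set_integrable: "set_integrable lborel {1..u} (\<lambda>t. iter_conv \<kappa> l (u - t) / t)"
  using iter_conv_props[of \<kappa> l] by auto

definition K_integrand :: "nat \<Rightarrow> nat \<Rightarrow> real \<Rightarrow> (nat \<Rightarrow> real) \<Rightarrow> real" where
  "K_integrand \<kappa> l u t =
     (if (\<forall>i\<in>{..<l}. 1 \<le> t i) \<and> (\<Sum>i<l. t i) \<le> u then (u - (\<Sum>i<l. t i)) ^ \<kappa> * (\<Prod>i<l. 1 / t i) else 0)"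

lemma K_integrand_measurable [measurable]:
  "K_integrand \<kappa> l u \<in> borel_measurable (\<Pi>\<^sub>M i\<in>{..<l}. lborel)"
  unfolding K_integrand_def by measurable

lemma K_integrand_nonneg: "0 \<le> K_integrand \<kappa> l u t"
proof -
  have "0 \<le> (\<Prod>i<l. 1 / t i)" if "\<forall>i\<in>{..<l}. 1 \<le> t i"
  proof (rule prod_nonneg)
    fix i assume "i \<in> {..<l}"
    with that have "1 \<le> t i" by blast
    thus "0 \<le> 1 / t i" by simp
  qed
  thus ?thesis
    by (simp add: K_integrand_def)
qed

lemma K_integrand_Suc:
  "K_integrand \<kappa> (Suc l) u (t(l := y)) = (if 1 \<le> y then 1 / y else 0) * K_integrand \<kappa> l (u - y) t"
proof -
  have "(\<Sum>i<l. (t(l := y)) i) = (\<Sum>i<l. t i)"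
    by (intro sum.cong) auto
  moreover have "(\<Prod>i<l. 1 / (t(l := y)) i) = (\<Prod>i<l. 1 / t i)"
    by (intro prod.cong) auto
  moreover have "(\<forall>i\<in>{..<Suc l}. 1 \<le> (t(l := y)) i) \<longleftrightarrow> 1 \<le> y \<and> (\<forall>i\<in>{..<l}. 1 \<le> t i)"
    by (auto simp: less_Suc_eq)
  ultimately show ?thesis
    by (auto simp: K_integrand_def algebra_simps)
qed

text \<open>
  Tonelli's theorem splits off the last variable. Nonnegative integrals avoid any question of integrability on
  the product space.
\<close>

lemma nn_integral_K_integrand:
  "(\<integral>\<^sup>+ t. ennreal (K_integrand \<kappa> l u t) \<partial>(\<Pi>\<^sub>M i\<in>{..<l}. lborel)) = ennreal (iter_conv \<kappa> l u)"
proof (induction l arbitrary: u)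
  case 0
  have "(\<lambda>t. ennreal (K_integrand \<kappa> 0 u t)) = (\<lambda>t. ennreal (iter_conv \<kappa> 0 u))"
    by (auto simp: K_integrand_def)
  thus ?case
    by (simp add: PiM_empty)
next
  case (Suc l)
  interpret product_sigma_finite "\<lambda>_::nat. lborel :: real measure" ..
  have "(\<integral>\<^sup>+ t. ennreal (K_integrand \<kappa> (Suc l) u t) \<partial>(\<Pi>\<^sub>M i\<in>{..<Suc l}. lborel)) =
        (\<integral>\<^sup>+ y. (\<integral>\<^sup>+ t. ennreal (K_integrand \<kappa> (Suc l) u (t(l := y))) \<partial>(\<Pi>\<^sub>M i\<in>{..<l}. lborel)) \<partial>lborel)"
    unfolding lessThan_Suc
    by (rule product_nn_integral_insert_rev) (simp_all flip: lessThan_Suc)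
  also have "\<dots> = (\<integral>\<^sup>+ y. ennreal (indicator {1..u} y *\<^sub>R (iter_conv \<kappa> l (u - y) / y)) \<partial>lborel)"
  proof (rule nn_integral_cong)
    fix y :: real
    have "(\<integral>\<^sup>+ t. ennreal (K_integrand \<kappa> (Suc l) u (t(l := y))) \<partial>(\<Pi>\<^sub>M i\<in>{..<l}. lborel)) =
          (\<integral>\<^sup>+ t. ennreal (if 1 \<le> y then 1 / y else 0) * ennreal (K_integrand \<kappa> l (u - y) t) \<partial>(\<Pi>\<^sub>M i\<in>{..<l}. lborel))"
      unfolding K_integrand_Suc by (intro nn_integral_cong ennreal_mult K_integrand_nonneg) auto
    also have "\<dots> = ennreal (if 1 \<le> y then 1 / y else 0) * ennreal (iter_conv \<kappa> l (u - y))"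
      by (subst nn_integral_cmult) (auto simp: Suc.IH)
    also have "\<dots> = ennreal ((if 1 \<le> y then 1 / y else 0) * iter_conv \<kappa> l (u - y))"
      by (intro ennreal_mult[symmetric] iter_conv_nonneg) auto
    also have "(if 1 \<le> y then 1 / y else 0) * iter_conv \<kappa> l (u - y) = indicator {1..u} y *\<^sub>R (iter_conv \<kappa> l (u - y) / y)"
      using iter_conv_neg[of "u - y" \<kappa> l] by (auto simp: indicator_def)
    finally show "(\<integral>\<^sup>+ t. ennreal (K_integrand \<kappa> (Suc l) u (t(l := y))) \<partial>(\<Pi>\<^sub>M i\<in>{..<l}. lborel)) =
       ennreal (indicator {1..u} y *\<^sub>R (iter_conv \<kappa> l (u - y) / y))" .
  qed
  also have "\<dots> = ennreal (iter_conv \<kappa> (Suc l) u)"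
    unfolding iter_conv.simps set_lebesgue_integral_def
    by (intro nn_integral_eq_integral)
       (use iter_conv_set_integrable[of u \<kappa> l] iter_conv_nonneg[of \<kappa> l] in
         \<open>auto simp: set_integrable_def indicator_def\<close>)
  finally show ?case .
qed

lemma K_eq_iter_conv:
  assumes "l \<ge> 1" "u > real l"
  shows "K l u \<kappa> = iter_conv \<kappa> l u / fact l"
proof -
  have "(LINT t : {t. (\<forall>i<l. 1 \<le> t i) \<and> (\<Sum>i<l. t i) \<le> u} | (\<Pi>\<^sub>M i\<in>{..<l}. lborel).
           (u - (\<Sum>i<l. t i)) ^ \<kappa> * (\<Prod>i<l. 1 / t i)) =
        (LINT t | (\<Pi>\<^sub>M i\<in>{..<l}. lborel). K_integrand \<kappa> l u t)"
    unfolding set_lebesgue_integral_def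
    by (intro Bochner_Integration.integral_cong) (auto simp: K_integrand_def indicator_def)
  also have "\<dots> = enn2real (\<integral>\<^sup>+ t. ennreal (K_integrand \<kappa> l u t) \<partial>(\<Pi>\<^sub>M i\<in>{..<l}. lborel))"
    by (intro integral_eq_nn_integral) (auto intro: K_integrand_nonneg)
  also have "\<dots> = iter_conv \<kappa> l u"
    by (simp add: nn_integral_K_integrand iter_conv_nonneg)
  finally show ?thesis
    using assms by (simp add: K_def)
qed

section \<open>The main term and its recursion\<close>

lemma Gamma_of_nat_plus_1: "Gamma (of_nat n + 1 :: complex) = fact n"
  using Gamma_fact[of n, where 'a = complex] by (simp add: add.commute)

text \<open>
  \<open>fact \<kappa> * main_term \<kappa> l\<close> is the main term for \<open>l!\<close> times \<open>K\<close>; see \<open>main_term_eq_D_coeff\<close>. The sum over \<open>n\<close> can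
  start at 0 because \<open>E_coeff n m\<close> vanishes for \<open>n < m\<close>. The factor \<open>(l - m)!\<close> compensates that \<open>power_log\<close> carries
  a factor \<open>1 / j!\<close>.
\<close>

definition main_term :: "nat \<Rightarrow> nat \<Rightarrow> real \<Rightarrow> complex" where
  "main_term \<kappa> l u =
     (\<Sum>m\<le>l. of_nat (l choose m) * (fact (l - m) * (\<Sum>n\<le>\<kappa>. E_coeff n m * power_log (\<kappa> - n) (l - m) u)))"

lemma main_term_0:
  assumes "u > 0"
  shows "fact \<kappa> * main_term \<kappa> 0 u = of_real (u ^ \<kappa>)"
proof -
  have "(\<lambda>r. C_coeff r \<kappa> * 0 ^ r) sums rGamma (of_nat \<kappa> + 1)"
    using C_coeff_sums[of \<kappa> 0] by simp
  hence "C_coeff 0 \<kappa> = rGamma (of_nat \<kappa> + 1)"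
    by (rule sums_unique2[OF powser_sums_zero])
  also have "\<dots> = 1 / fact \<kappa>"
    by (simp add: rGamma_inverse_Gamma Gamma_of_nat_plus_1 divide_inverse)
  finally have "C_coeff 0 \<kappa> = 1 / fact \<kappa>" .
  moreover have "main_term \<kappa> 0 u = power_log \<kappa> 0 u"
  proof -
    have "main_term \<kappa> 0 u = (\<Sum>n\<le>\<kappa>. E_coeff n 0 * power_log (\<kappa> - n) 0 u)"
      by (simp add: main_term_def)
    also have "\<dots> = (\<Sum>n\<le>\<kappa>. if n = 0 then power_log \<kappa> 0 u else 0)"
      by (intro sum.cong) (auto simp: E_coeff_zero_right)
    finally show ?thesis by simp
  qed
  ultimately show ?thesis
    by (simp add: power_log_def)
qed

lemma sum_choose_Suc:
  fixes G :: "nat \<Rightarrow> 'a :: comm_semiring_1"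
  shows "(\<Sum>m\<le>Suc l. of_nat (Suc l choose m) * G m) =
           (\<Sum>m\<le>l. of_nat (l choose m) * G m) + (\<Sum>m\<le>l. of_nat (l choose m) * G (Suc m))"
proof -
  have 1: "(\<Sum>m\<le>Suc l. of_nat (Suc l choose m) * G m) =
        G 0 + (\<Sum>m\<le>l. of_nat (l choose m) * G (Suc m)) + (\<Sum>m\<le>l. of_nat (l choose Suc m) * G (Suc m))"
    by (subst sum.atMost_Suc_shift) (simp add: algebra_simps sum.distrib)
  have "(\<Sum>m\<le>l. of_nat (l choose m) * G m) = (\<Sum>m\<le>Suc l. of_nat (l choose m) * G m)"
    by (simp add: binomial_eq_0)
  also have "\<dots> = G 0 + (\<Sum>m\<le>l. of_nat (l choose Suc m) * G (Suc m))"
    by (subst sum.atMost_Suc_shift) simp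
  finally show ?thesis
    unfolding 1 by (simp only: add_ac)
qed

text \<open>
  Multiplication by the Taylor series of \<open>Ein\<close>, truncated at degree \<open>\<kappa>\<close>, maps the coefficients of
  \<open>Ein\<^bsup>m\<^esup>\<close> to those of \<open>Ein\<^bsup>m+1\<^esup>\<close>.
\<close>

lemma sum_E_coeff_convolve:
  "(\<Sum>n\<le>\<kappa>. E_coeff n m * (\<Sum>i\<le>\<kappa> - n. E_coeff i 1 * f (\<kappa> - n - i))) =
   (\<Sum>n\<le>\<kappa>. E_coeff n (Suc m) * (f (\<kappa> - n) :: complex))"
proof -
  have "(\<Sum>n\<le>\<kappa>. E_coeff n m * (\<Sum>i\<le>\<kappa> - n. E_coeff i 1 * f (\<kappa> - n - i))) =
        (\<Sum>(n, i) \<in> Sigma {..\<kappa>} (\<lambda>n. {..\<kappa> - n}). E_coeff n m * (E_coeff i 1 * f (\<kappa> - n - i)))"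
    by (simp add: sum.Sigma sum_distrib_left)
  also have "Sigma {..\<kappa>} (\<lambda>n. {..\<kappa> - n}) = {(n, i). n + i \<le> \<kappa>}"
    by auto
  also have "(\<Sum>(n, i) \<in> {(n, i). n + i \<le> \<kappa>}. E_coeff n m * (E_coeff i 1 * f (\<kappa> - n - i))) =
      (\<Sum>(i, n) \<in> {(i, n). i + n \<le> \<kappa>}. E_coeff n m * (E_coeff i 1 * f (\<kappa> - n - i)))"
    by (rule sum.reindex_bij_witness[of _ prod.swap prod.swap]) (auto simp: add.commute)
  also have "\<dots> = (\<Sum>n\<le>\<kappa>. \<Sum>i\<le>n. E_coeff (n - i) m * (E_coeff i 1 * f (\<kappa> - (n - i) - i)))"
    by (rule sum.triangle_reindex_eq)
  also have "\<dots> = (\<Sum>n\<le>\<kappa>. E_coeff n (Suc m) * f (\<kappa> - n))"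
    unfolding E_coeff_Suc_right sum_distrib_right
    by (intro sum.cong) (auto simp: mult_ac)
  finally show ?thesis .
qed

text \<open>
  This is \<open>(A + B)\<^bsup>l+1\<^esup> = (A + B) * (A + B)\<^bsup>l\<^esup>\<close> for \<open>A = - \<gamma> - log s\<close> and \<open>B = Ein s\<close>, by Pascal's rule: in each
  summand of level \<open>l\<close>, \<open>A\<close> raises the power of the logarithm and \<open>B\<close> raises \<open>m\<close>.
\<close>

lemma main_term_Suc:
  "main_term \<kappa> (Suc l) u =
     (\<Sum>m\<le>l. of_nat (l choose m) * (fact (l - m) * (\<Sum>n\<le>\<kappa>. E_coeff n m *
       (of_nat (Suc (l - m)) * power_log (\<kappa> - n) (Suc (l - m)) u
        + (\<Sum>i\<le>\<kappa> - n. E_coeff i 1 * power_log (\<kappa> - n - i) (l - m) u)))))"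
proof -
  define S where "S m j = (\<Sum>n\<le>\<kappa>. E_coeff n m * power_log (\<kappa> - n) j u)" for m j
  have "main_term \<kappa> (Suc l) u = (\<Sum>m\<le>Suc l. of_nat (Suc l choose m) * (fact (Suc l - m) * S m (Suc l - m)))"
    by (simp add: main_term_def S_def)
  also have "\<dots> = (\<Sum>m\<le>l. of_nat (l choose m) * (fact (Suc l - m) * S m (Suc l - m))) +
                  (\<Sum>m\<le>l. of_nat (l choose m) * (fact (Suc l - Suc m) * S (Suc m) (Suc l - Suc m)))"
    by (rule sum_choose_Suc)
  also have "\<dots> = (\<Sum>m\<le>l. of_nat (l choose m) * (fact (l - m) *
       (of_nat (Suc (l - m)) * S m (Suc (l - m)) + S (Suc m) (l - m))))"
    unfolding sum.distrib[symmetric]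
    by (intro sum.cong refl) (auto simp: Suc_diff_le algebra_simps)
  also have "\<dots> = (\<Sum>m\<le>l. of_nat (l choose m) * (fact (l - m) * (\<Sum>n\<le>\<kappa>. E_coeff n m *
       (of_nat (Suc (l - m)) * power_log (\<kappa> - n) (Suc (l - m)) u
        + (\<Sum>i\<le>\<kappa> - n. E_coeff i 1 * power_log (\<kappa> - n - i) (l - m) u)))))"
  proof (intro sum.cong refl arg_cong2[where f = "(*)"])
    fix m
    show "of_nat (Suc (l - m)) * S m (Suc (l - m)) + S (Suc m) (l - m) =
      (\<Sum>n\<le>\<kappa>. E_coeff n m * (of_nat (Suc (l - m)) * power_log (\<kappa> - n) (Suc (l - m)) u
        + (\<Sum>i\<le>\<kappa> - n. E_coeff i 1 * power_log (\<kappa> - n - i) (l - m) u)))"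
      unfolding distrib_left sum.distrib S_def sum_E_coeff_convolve[where f = "\<lambda>k. power_log k (l - m) u"]
      by (simp add: sum_distrib_left mult_ac)
  qed
  finally show ?thesis .
qed

lemma continuous_on_main_term: "continuous_on {0<..} (main_term \<kappa> l)"
  unfolding main_term_def by (intro continuous_intros continuous_on_power_log)

lemma continuous_on_main_term_over_t:
  "continuous_on {1..u - 1} (\<lambda>t. main_term \<kappa> l (u - t) / of_real t)"
  by (intro continuous_intros continuous_on_compose2[OF continuous_on_main_term]) auto

lemma integral_main_term:
  "integral {1..u - 1} (\<lambda>t. main_term \<kappa> l (u - t) / of_real t) = main_term \<kappa> (Suc l) u +
     (\<Sum>m\<le>l. of_nat (l choose m) * (fact (l - m) * (\<Sum>n\<le>\<kappa>. E_coeff n m * convolution_defect (\<kappa> - n) (l - m) u)))"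
proof -
  define I where "I k j = integral {1..u - 1} (\<lambda>t. power_log k j (u - t) / of_real t)" for k j
  have I: "((\<lambda>t. power_log k j (u - t) / of_real t) has_integral I k j) {1..u - 1}" for k j
    unfolding I_def by (intro integrable_integral integrable_continuous_real continuous_on_power_log_over_t)
  have "((\<lambda>t. \<Sum>m\<le>l. of_nat (l choose m) * (fact (l - m) *
           (\<Sum>n\<le>\<kappa>. E_coeff n m * (power_log (\<kappa> - n) (l - m) (u - t) / of_real t)))) has_integral
         (\<Sum>m\<le>l. of_nat (l choose m) * (fact (l - m) * (\<Sum>n\<le>\<kappa>. E_coeff n m * I (\<kappa> - n) (l - m))))) {1..u - 1}"
    by (intro has_integral_sum has_integral_mult_right I) auto
  also have "(\<lambda>t. \<Sum>m\<le>l. of_nat (l choose m) * (fact (l - m) *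
           (\<Sum>n\<le>\<kappa>. E_coeff n m * (power_log (\<kappa> - n) (l - m) (u - t) / of_real t)))) =
      (\<lambda>t. main_term \<kappa> l (u - t) / of_real t)"
    by (simp add: main_term_def sum_divide_distrib sum_distrib_left)
  finally have "integral {1..u - 1} (\<lambda>t. main_term \<kappa> l (u - t) / of_real t) =
      (\<Sum>m\<le>l. of_nat (l choose m) * (fact (l - m) * (\<Sum>n\<le>\<kappa>. E_coeff n m * I (\<kappa> - n) (l - m))))"
    by (rule integral_unique)
  also have "\<dots> = main_term \<kappa> (Suc l) u + (\<Sum>m\<le>l. of_nat (l choose m) * (fact (l - m) *
      (\<Sum>n\<le>\<kappa>. E_coeff n m * convolution_defect (\<kappa> - n) (l - m) u)))"
  proof -
    have "I k j = (of_nat (Suc j) * power_log k (Suc j) u + (\<Sum>i\<le>k. E_coeff i 1 * power_log (k - i) j u))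
        + convolution_defect k j u" for k j
      by (simp add: I_def convolution_defect_def)
    thus ?thesis
      unfolding main_term_Suc sum.distrib[symmetric] distrib_left[symmetric] by (simp only:)
  qed
  finally show ?thesis .
qed

section \<open>Induction on the number of variables\<close>

lemma ln_exp_mult: "u > 0 \<Longrightarrow> ln (exp 1 * u) = 1 + ln (u :: real)"
  by (simp add: ln_mult)

lemma integral_main_term_bound:
  "\<exists>A\<ge>0. \<forall>u\<ge>4. norm (integral {1..u - 1} (\<lambda>t. main_term \<kappa> l (u - t) / of_real t) - main_term \<kappa> (Suc l) u)
     \<le> A * (ln (exp 1 * u) ^ l / u)"
proof -
  obtain A where A: "\<And>k j. A k j \<ge> 0"
      "\<And>k j u. u \<ge> 4 \<Longrightarrow> norm (convolution_defect k j u) \<le> A k j * (ln (exp 1 * u) ^ j / u)"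
    using convolution_defect_bound by metis
  define B where "B = (\<Sum>m\<le>l. real (l choose m) * (fact (l - m) * (\<Sum>n\<le>\<kappa>. norm (E_coeff n m) * A (\<kappa> - n) (l - m))))"
  have B0: "B \<ge> 0"
    unfolding B_def by (intro sum_nonneg mult_nonneg_nonneg A) auto
  have "norm (integral {1..u - 1} (\<lambda>t. main_term \<kappa> l (u - t) / of_real t) - main_term \<kappa> (Suc l) u)
     \<le> B * (ln (exp 1 * u) ^ l / u)" if u: "u \<ge> 4" for u
  proof -
    define e where "e = ln (exp 1 * u) ^ l / u"
    have L: "ln (exp 1 * u) \<ge> 1"
      using u by (simp add: ln_exp_mult)
    have d: "norm (convolution_defect k j u) \<le> A k j * e" if "j \<le> l" for k j
    proof -
      have "ln (exp 1 * u) ^ j \<le> ln (exp 1 * u) ^ l"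
        using L that by (intro power_increasing)
      hence "A k j * (ln (exp 1 * u) ^ j / u) \<le> A k j * e"
        unfolding e_def using u A by (intro mult_left_mono divide_right_mono) auto
      thus ?thesis using A(2)[OF u, of k j] by linarith
    qed
    have "norm (\<Sum>m\<le>l. of_nat (l choose m) * (fact (l - m) * (\<Sum>n\<le>\<kappa>. E_coeff n m * convolution_defect (\<kappa> - n) (l - m) u)))
        \<le> (\<Sum>m\<le>l. real (l choose m) * (fact (l - m) * (\<Sum>n\<le>\<kappa>. norm (E_coeff n m) * (A (\<kappa> - n) (l - m) * e))))"
    proof (intro sum_norm_le)
      fix m assume "m \<in> {..l}"
      have "norm (\<Sum>n\<le>\<kappa>. E_coeff n m * convolution_defect (\<kappa> - n) (l - m) u)
          \<le> (\<Sum>n\<le>\<kappa>. norm (E_coeff n m) * (A (\<kappa> - n) (l - m) * e))"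
        by (intro sum_norm_le) (auto simp: norm_mult intro!: mult_left_mono d)
      thus "norm (of_nat (l choose m) * (fact (l - m) * (\<Sum>n\<le>\<kappa>. E_coeff n m * convolution_defect (\<kappa> - n) (l - m) u)))
          \<le> real (l choose m) * (fact (l - m) * (\<Sum>n\<le>\<kappa>. norm (E_coeff n m) * (A (\<kappa> - n) (l - m) * e)))"
        by (simp add: norm_mult mult_left_mono)
    qed
    also have "\<dots> = B * e"
      by (simp add: B_def sum_distrib_right mult.assoc)
    finally show ?thesis
      by (simp add: integral_main_term e_def)
  qed
  with B0 show ?thesis by blast
qed

lemma has_integral_reciprocal_product:
  fixes u :: real
  assumes u: "u \<ge> 2"
  shows "((\<lambda>t. 1 / ((u - t) * t)) has_integral 2 * ln (u - 1) / u) {1..u - 1}"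
proof -
  have "((\<lambda>t. 1 / ((u - t) * t)) has_integral
      ((ln (u - 1) - ln (u - (u - 1))) / u - (ln 1 - ln (u - 1)) / u)) {1..u - 1}"
  proof (rule fundamental_theorem_of_calculus)
    fix t assume t: "t \<in> {1..u - 1}"
    have "((\<lambda>t. (ln t - ln (u - t)) / u) has_real_derivative 1 / ((u - t) * t)) (at t within {1..u - 1})"
      using t u by (auto intro!: derivative_eq_intros simp: divide_simps)
    thus "((\<lambda>t. (ln t - ln (u - t)) / u) has_vector_derivative 1 / ((u - t) * t)) (at t within {1..u - 1})"
      by (simp add: has_real_derivative_iff_has_vector_derivative)
  qed (use u in auto)
  thus ?thesis by (simp add: diff_divide_distrib)
qed

text \<open>
  On \<open>[u - 1, u]\<close> the argument \<open>u - t\<close> is at most 1, so \<open>iter_conv \<kappa> l\<close> is at most 1 there and the weight \<open>1 / t\<close> makes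
  the contribution \<open>O(1 / u)\<close>.
\<close>

lemma iter_conv_Suc_split:
  assumes u: "u \<ge> 2"
  shows "(\<lambda>t. iter_conv \<kappa> l (u - t) / t) integrable_on {1..u - 1}"
    and "\<bar>iter_conv \<kappa> (Suc l) u - integral {1..u - 1} (\<lambda>t. iter_conv \<kappa> l (u - t) / t)\<bar> \<le> 2 / u"
proof -
  let ?f = "\<lambda>t. iter_conv \<kappa> l (u - t) / t"
  have int: "?f integrable_on {1..u}" and eq: "iter_conv \<kappa> (Suc l) u = integral {1..u} ?f"
    using set_borel_integral_eq_integral[OF iter_conv_set_integrable] by auto
  show i1: "?f integrable_on {1..u - 1}"
    by (rule integrable_on_subinterval[OF int]) auto
  have i2: "?f integrable_on {u - 1..u}"
    by (rule integrable_on_subinterval[OF int]) (use u in auto)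
  have "integral {1..u} ?f = integral {1..u - 1} ?f + integral {u - 1..u} ?f"
    by (rule Henstock_Kurzweil_Integration.integral_combine[symmetric]) (use u int in auto)
  moreover have "norm (integral {u - 1..u} ?f) \<le> integral {u - 1..u} (\<lambda>t. 2 / u)"
  proof (rule integral_norm_bound_integral[OF i2])
    fix t assume t: "t \<in> {u - 1..u}"
    have "iter_conv \<kappa> l (u - t) \<le> 1"
      using order_trans[OF iter_conv_le[of \<kappa> l "u - t"] power_le_one[of "max 0 (u - t)"]] t by auto
    moreover have "1 / t \<le> 2 / u" "t > 0"
      using t u by (auto simp: divide_simps)
    ultimately have "iter_conv \<kappa> l (u - t) * (1 / t) \<le> 1 * (2 / u)"
      using u by (intro mult_mono) auto
    thus "norm (?f t) \<le> 2 / u"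
      using \<open>t > 0\<close> iter_conv_nonneg[of \<kappa> l "u - t"] by simp
  qed auto
  ultimately show "\<bar>iter_conv \<kappa> (Suc l) u - integral {1..u - 1} ?f\<bar> \<le> 2 / u"
    unfolding eq by simp
qed

text \<open>
  At level 0 the main term is exact. In the step, the part of the convolution with \<open>t \<le> u - 1\<close> reaches only
  arguments \<open>u - t \<ge> 1\<close>, where the induction hypothesis applies; its error is integrated against \<open>1 / t\<close>.
\<close>

lemma iter_conv_asymptotics:
  "\<exists>A\<ge>0. \<forall>u\<ge>1. norm (of_real (iter_conv \<kappa> l u) - fact \<kappa> * main_term \<kappa> l u) \<le> A * (ln (exp 1 * u) ^ l / u)"
proof (induction l)
  case 0
  show ?case
    by (rule exI[of _ 0]) (use main_term_0 in auto)
next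
  case (Suc l)
  then obtain A where A: "A \<ge> 0"
    "\<And>u. u \<ge> 1 \<Longrightarrow> norm (of_real (iter_conv \<kappa> l u) - fact \<kappa> * main_term \<kappa> l u) \<le> A * (ln (exp 1 * u) ^ l / u)"
    by blast
  obtain B where B: "B \<ge> 0"
    "\<And>u. u \<ge> 4 \<Longrightarrow> norm (integral {1..u - 1} (\<lambda>t. main_term \<kappa> l (u - t) / of_real t) - main_term \<kappa> (Suc l) u)
     \<le> B * (ln (exp 1 * u) ^ l / u)"
    using integral_main_term_bound[of \<kappa> l] by blast
  \<comment> \<open>The threshold 4 is the one of \<open>convolution_defect_bound\<close>.\<close>
  have large: "norm (of_real (iter_conv \<kappa> (Suc l) u) - fact \<kappa> * main_term \<kappa> (Suc l) u)
      \<le> (2 + 2 * A + fact \<kappa> * B) * (ln (exp 1 * u) ^ Suc l / u)" if u: "u \<ge> 4" for u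
  proof -
    define L where "L = ln (exp 1 * u)"
    have L: "L = 1 + ln u" using u by (simp add: L_def ln_exp_mult)
    have L1: "L \<ge> 1" using u by (simp add: L)
    let ?f = "\<lambda>t. iter_conv \<kappa> l (u - t) / t"
    let ?g = "\<lambda>t. main_term \<kappa> l (u - t) / of_real t"
    have u2: "u \<ge> 2" using u by simp
    have fi: "?f integrable_on {1..u - 1}"
      by (rule iter_conv_Suc_split(1)[OF u2])
    have cf: "((\<lambda>t. complex_of_real (?f t)) has_integral of_real (integral {1..u - 1} ?f)) {1..u - 1}"
      using has_integral_linear[OF integrable_integral[OF fi] bounded_linear_of_real[where 'a = complex]] by (simp add: o_def)
    have cg: "(?g has_integral integral {1..u - 1} ?g) {1..u - 1}"
      by (intro integrable_integral integrable_continuous_real continuous_on_main_term_over_t)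
    have diff: "((\<lambda>t. of_real (?f t) - fact \<kappa> * ?g t) has_integral
       (of_real (integral {1..u - 1} ?f) - fact \<kappa> * integral {1..u - 1} ?g)) {1..u - 1}"
      by (intro has_integral_diff has_integral_mult_right cf cg)
    have rec: "((\<lambda>t. A * L ^ l * (1 / ((u - t) * t))) has_integral A * L ^ l * (2 * ln (u - 1) / u)) {1..u - 1}"
      by (intro has_integral_mult_right has_integral_reciprocal_product u2)
    have "norm (integral {1..u - 1} (\<lambda>t. of_real (?f t) - fact \<kappa> * ?g t))
       \<le> integral {1..u - 1} (\<lambda>t. A * L ^ l * (1 / ((u - t) * t)))"
    proof (rule integral_norm_bound_integral)
      show "(\<lambda>t. of_real (?f t) - fact \<kappa> * ?g t) integrable_on {1..u - 1}"
           "(\<lambda>t. A * L ^ l * (1 / ((u - t) * t))) integrable_on {1..u - 1}"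
        using diff rec by blast+
      fix t assume t: "t \<in> {1..u - 1}"
      have "of_real (?f t) - fact \<kappa> * ?g t = (of_real (iter_conv \<kappa> l (u - t)) - fact \<kappa> * main_term \<kappa> l (u - t)) / of_real t"
        by (simp add: diff_divide_distrib)
      hence "norm (of_real (?f t) - fact \<kappa> * ?g t) =
          norm (of_real (iter_conv \<kappa> l (u - t)) - fact \<kappa> * main_term \<kappa> l (u - t)) / t"
        using t by (simp add: norm_divide)
      also have "\<dots> \<le> A * (ln (exp 1 * (u - t)) ^ l / (u - t)) / t"
        using t by (intro divide_right_mono A(2)) auto
      also have "\<dots> \<le> A * (L ^ l / (u - t)) / t"
      proof (intro divide_right_mono mult_left_mono power_mono A(1))
        show "ln (exp 1 * (u - t)) \<le> L"
          unfolding L_def using t by (subst ln_le_cancel_iff) auto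
        show "0 \<le> ln (exp 1 * (u - t))"
          using t by (simp add: ln_exp_mult)
      qed (use t in auto)
      finally show "norm (of_real (?f t) - fact \<kappa> * ?g t) \<le> A * L ^ l * (1 / ((u - t) * t))"
        by simp
    qed
    hence e2: "norm (of_real (integral {1..u - 1} ?f) - fact \<kappa> * integral {1..u - 1} ?g) \<le> A * L ^ l * (2 * ln (u - 1) / u)"
      using integral_unique[OF diff] integral_unique[OF rec] by simp
    have e1: "norm (of_real (iter_conv \<kappa> (Suc l) u) - complex_of_real (integral {1..u - 1} ?f)) \<le> 2 / u"
      using iter_conv_Suc_split(2)[OF u2, of \<kappa> l] by (simp flip: of_real_diff)
    have e3: "norm (fact \<kappa> * (integral {1..u - 1} ?g - main_term \<kappa> (Suc l) u)) \<le> fact \<kappa> * (B * (L ^ l / u))"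
      unfolding norm_mult norm_fact L_def by (rule mult_left_mono[OF B(2)[OF u]]) simp
    have "of_real (iter_conv \<kappa> (Suc l) u) - fact \<kappa> * main_term \<kappa> (Suc l) u =
       (of_real (iter_conv \<kappa> (Suc l) u) - complex_of_real (integral {1..u - 1} ?f)) +
       (of_real (integral {1..u - 1} ?f) - fact \<kappa> * integral {1..u - 1} ?g) +
       fact \<kappa> * (integral {1..u - 1} ?g - main_term \<kappa> (Suc l) u)"
      by (simp add: algebra_simps)
    hence "norm (of_real (iter_conv \<kappa> (Suc l) u) - fact \<kappa> * main_term \<kappa> (Suc l) u) \<le>
        2 / u + A * L ^ l * (2 * ln (u - 1) / u) + fact \<kappa> * (B * (L ^ l / u))"
      using e1 e2 e3 by (metis (no_types, lifting) add_mono norm_triangle_le)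
    also have "\<dots> \<le> 2 * (L ^ Suc l / u) + 2 * A * (L ^ Suc l / u) + fact \<kappa> * B * (L ^ Suc l / u)"
    proof (intro add_mono)
      have "1 \<le> L ^ Suc l" using L1 by (rule one_le_power)
      thus "2 / u \<le> 2 * (L ^ Suc l / u)"
        using u by (simp add: divide_right_mono)
      have "ln (u - 1) \<le> L"
      proof -
        have "ln (u - 1) \<le> ln u" using u by (subst ln_le_cancel_iff) auto
        thus ?thesis by (simp add: L)
      qed
      hence "A * L ^ l * (2 * ln (u - 1) / u) \<le> A * L ^ l * (2 * L / u)"
        using A L1 u by (intro mult_left_mono divide_right_mono) auto
      thus "A * L ^ l * (2 * ln (u - 1) / u) \<le> 2 * A * (L ^ Suc l / u)"
        by (simp add: mult_ac)
      have "L ^ l \<le> L ^ Suc l" using L1 by (intro power_increasing) auto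
      hence "fact \<kappa> * B * (L ^ l / u) \<le> fact \<kappa> * B * (L ^ Suc l / u)"
        using B u by (intro mult_left_mono divide_right_mono) auto
      thus "fact \<kappa> * (B * (L ^ l / u)) \<le> fact \<kappa> * B * (L ^ Suc l / u)"
        by (simp only: mult.assoc)
    qed
    also have "\<dots> = (2 + 2 * A + fact \<kappa> * B) * (L ^ Suc l / u)"
      by (simp only: distrib_right)
    finally show ?thesis by (simp only: L_def)
  qed
  \<comment> \<open>On \<open>[1, 4]\<close> everything is bounded, and \<open>log\<^bsup>l+1\<^esup> (e * u) / u \<ge> 1 / 4\<close>.\<close>
  have "continuous_on {1..4} (main_term \<kappa> (Suc l))"
    by (rule continuous_on_subset[OF continuous_on_main_term]) auto
  hence "compact (main_term \<kappa> (Suc l) ` {1..4})"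
    by (rule compact_continuous_image) simp
  then obtain G where "\<forall>y \<in> main_term \<kappa> (Suc l) ` {1..4}. norm y \<le> G"
    using compact_imp_bounded bounded_iff by meson
  hence G: "norm (main_term \<kappa> (Suc l) u) \<le> G" if "u \<in> {1..4}" for u
    using that by blast
  have G0: "G \<ge> 0"
    using order_trans[OF norm_ge_zero G[of 1]] by simp
  define D where "D = 4 * (4 ^ (\<kappa> + Suc l) + fact \<kappa> * G)"
  have D0: "D \<ge> 0" using G0 by (simp add: D_def)
  have small: "norm (of_real (iter_conv \<kappa> (Suc l) u) - fact \<kappa> * main_term \<kappa> (Suc l) u)
      \<le> D * (ln (exp 1 * u) ^ Suc l / u)" if u: "1 \<le> u" "u \<le> 4" for u
  proof -
    have "iter_conv \<kappa> (Suc l) u \<le> max 0 u ^ (\<kappa> + Suc l)"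
      by (rule iter_conv_le)
    also have "\<dots> \<le> 4 ^ (\<kappa> + Suc l)"
      using u by (intro power_mono) auto
    finally have "norm (complex_of_real (iter_conv \<kappa> (Suc l) u)) \<le> 4 ^ (\<kappa> + Suc l)"
      using iter_conv_nonneg[of \<kappa> "Suc l" u] by (simp del: iter_conv.simps)
    moreover have "norm (fact \<kappa> * main_term \<kappa> (Suc l) u) \<le> fact \<kappa> * G"
      unfolding norm_mult using G[of u] u by (simp add: mult_left_mono)
    ultimately have "norm (of_real (iter_conv \<kappa> (Suc l) u) - fact \<kappa> * main_term \<kappa> (Suc l) u) \<le>
        4 ^ (\<kappa> + Suc l) + fact \<kappa> * G"
      by (rule order_trans[OF norm_triangle_ineq4 add_mono])
    also have "\<dots> = D * (1 / 4)"
      by (simp add: D_def)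
    also have "\<dots> \<le> D * (ln (exp 1 * u) ^ Suc l / u)"
    proof (rule mult_left_mono[OF _ D0])
      have "1 \<le> ln (exp 1 * u)" using u by (simp add: ln_exp_mult)
      hence "1 \<le> ln (exp 1 * u) ^ Suc l" by (rule one_le_power)
      hence "1 / 4 \<le> ln (exp 1 * u) ^ Suc l / 4" by simp
      also have "\<dots> \<le> ln (exp 1 * u) ^ Suc l / u"
        using u \<open>1 \<le> ln (exp 1 * u) ^ Suc l\<close> by (intro divide_left_mono) auto
      finally show "1 / 4 \<le> ln (exp 1 * u) ^ Suc l / u" .
    qed
    finally show ?thesis .
  qed
  define C where "C = D + (2 + 2 * A + fact \<kappa> * B)"
  have C0: "C \<ge> 0" using D0 A B by (simp add: C_def)
  have "norm (of_real (iter_conv \<kappa> (Suc l) u) - fact \<kappa> * main_term \<kappa> (Suc l) u)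
      \<le> C * (ln (exp 1 * u) ^ Suc l / u)" if u: "u \<ge> 1" for u
  proof -
    have e0: "ln (exp 1 * u) ^ Suc l / u \<ge> 0"
      using u by (simp add: ln_exp_mult)
    have "D * (ln (exp 1 * u) ^ Suc l / u) \<le> C * (ln (exp 1 * u) ^ Suc l / u)"
         "(2 + 2 * A + fact \<kappa> * B) * (ln (exp 1 * u) ^ Suc l / u) \<le> C * (ln (exp 1 * u) ^ Suc l / u)"
      using A B D0 by (intro mult_right_mono[OF _ e0]; simp add: C_def)+
    thus ?thesis
      using small[of u] large[of u] u by (cases "u \<ge> 4") linarith+
  qed
  with C0 show ?case by blast
qed

section \<open>The asymptotic expansion\<close>

lemma main_term_eq_D_coeff:
  "fact \<kappa> * main_term \<kappa> l u / fact l =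
     (\<Sum>m=0..min \<kappa> l. \<Sum>n=m..\<kappa>. \<Sum>r=0..l - m.
         D_coeff m n r \<kappa> l * of_real (u ^ (\<kappa> - n) * ln u ^ (l - m - r)))"
proof -
  define T where "T m n = (\<Sum>r=0..l - m. D_coeff m n r \<kappa> l * of_real (u ^ (\<kappa> - n) * ln u ^ (l - m - r)))" for m n
  have T: "fact \<kappa> * (of_nat (l choose m) * (fact (l - m) * (E_coeff n m * power_log (\<kappa> - n) (l - m) u))) / fact l = T m n"
    if "m \<le> l" for m n
  proof -
    have b: "of_nat (l choose m) * fact (l - m) / fact l = (1 / fact m :: complex)"
      using binomial_fact[OF that, where 'a = complex] by simp
    have "fact \<kappa> * (of_nat (l choose m) * (fact (l - m) * (E_coeff n m * power_log (\<kappa> - n) (l - m) u))) / fact l =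
       fact \<kappa> * (of_nat (l choose m) * fact (l - m) / fact l) * (E_coeff n m * power_log (\<kappa> - n) (l - m) u)"
      by simp
    also have "\<dots> = T m n"
      unfolding b T_def D_coeff_def power_log_def sum_distrib_left atLeast0AtMost
      by (intro sum.cong refl) (simp add: Gamma_of_nat_plus_1)
    finally show ?thesis .
  qed
  have T0: "T m n = 0" if "n < m" for m n
    using that by (simp add: T_def D_coeff_def E_coeff_eq_0)
  have "fact \<kappa> * main_term \<kappa> l u / fact l = (\<Sum>m\<le>l. \<Sum>n\<le>\<kappa>. T m n)"
    unfolding main_term_def sum_distrib_left sum_divide_distrib
    by (intro sum.cong refl T) auto
  also have "\<dots> = (\<Sum>m=0..min \<kappa> l. \<Sum>n\<le>\<kappa>. T m n)"
    by (intro sum.mono_neutral_right) (auto intro!: sum.neutral T0)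
  also have "\<dots> = (\<Sum>m=0..min \<kappa> l. \<Sum>n=m..\<kappa>. T m n)"
    by (intro sum.cong refl sum.mono_neutral_right) (auto intro!: T0)
  finally show ?thesis
    by (simp add: T_def)
qed

theorem theorem2:
  fixes \<kappa> l :: nat
  assumes "l \<ge> 1"
  shows "\<exists>A::real. \<forall>u::real. u \<ge> real l \<longrightarrow>
    norm (complex_of_real (K l u \<kappa>) -
      (\<Sum>m=0..min \<kappa> l. \<Sum>n=m..\<kappa>. \<Sum>r=0..l - m.
         D_coeff m n r \<kappa> l * of_real (u ^ (\<kappa> - n) * ln u ^ (l - m - r))))
    \<le> A * (ln (exp 1 * u) ^ l / u)"
proof -
  obtain A where A: "A \<ge> 0" "\<And>u. u \<ge> 1 \<Longrightarrow>
      norm (of_real (iter_conv \<kappa> l u) - fact \<kappa> * main_term \<kappa> l u) \<le> A * (ln (exp 1 * u) ^ l / u)"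
    using iter_conv_asymptotics by blast
  let ?err = "\<lambda>u. norm (complex_of_real (K l u \<kappa>) - fact \<kappa> * main_term \<kappa> l u / fact l)"
  let ?e = "\<lambda>u::real. ln (exp 1 * u) ^ l / u"
  have e_pos: "?e u > 0" if "u \<ge> real l" for u
    using that assms by (auto simp: ln_exp_mult intro!: divide_pos_pos zero_less_power add_pos_nonneg)
  \<comment> \<open>At \<open>u = l\<close> the function \<open>K\<close> is 0 by convention and not by the integral. This single point is absorbed into
    the constant.\<close>
  define A' where "A' = max A (?err (real l) / ?e (real l))"
  have "?err u \<le> A' * ?e u" if u: "u \<ge> real l" for u
  proof (cases "u = real l")
    case True
    have "?err u = ?err (real l) / ?e (real l) * ?e u"
    proof -
      have "x = x / y * y" if "y > 0" for x y :: real
        using that by simp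
      thus ?thesis
        unfolding True using e_pos[of "real l"] by blast
    qed
    also have "\<dots> \<le> A' * ?e u"
      using e_pos[OF u] by (intro mult_right_mono) (auto simp: A'_def)
    finally show ?thesis .
  next
    case False
    hence "complex_of_real (K l u \<kappa>) - fact \<kappa> * main_term \<kappa> l u / fact l =
        (of_real (iter_conv \<kappa> l u) - fact \<kappa> * main_term \<kappa> l u) / fact l"
      using K_eq_iter_conv[OF assms, of u \<kappa>] u by (simp add: diff_divide_distrib)
    hence "?err u = norm (of_real (iter_conv \<kappa> l u) - fact \<kappa> * main_term \<kappa> l u) / fact l"
      by (simp add: norm_divide)
    also have "\<dots> \<le> norm (of_real (iter_conv \<kappa> l u) - fact \<kappa> * main_term \<kappa> l u) / 1"
      by (intro divide_left_mono) auto
    also have "\<dots> \<le> A * ?e u"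
      using A(2)[of u] u assms by simp
    also have "\<dots> \<le> A' * ?e u"
      using e_pos[OF u] by (intro mult_right_mono) (auto simp: A'_def)
    finally show ?thesis .
  qed
  thus ?thesis
    unfolding main_term_eq_D_coeff by blast
qed

end
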